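(* Let $r\ge 2$, let $s_1,\ldots,s_{r-1},t$ be positive integers, and set $s=\prod_{i=1}^{r-1}s_i$. Suppose $2\le s\le t$. There exists a constant $c>0$, depending only on $r,s_1,\ldots,s_{r-1},t$, such that for all positive integers $m_1,\ldots,m_{r-1},n$ for which $m=\prod_{i=1}^{r-1}m_i$ satisfies $$m\ \le\ n^{\,t^{1/(s-1)}/(s(s-1))},$$ we have $$z(m_1,m_2,\ldots,m_{r-1},n;s_1,s_2,\ldots,s_{r-1},t)\ \ge\ c\, m_1m_2\cdots m_{r-1}\, n^{\,1-\frac{1}{s_1s_2\cdots s_{r-1}}}.$$
   Context: An $r$-graph $H$ is a pair $(V(H),E(H))$ where $E(H)$ is a collection of $r$-element subsets of the finite set $V(H)$. It is $r$-partite with parts $V_1,\ldots,V_r$ if $V(H)$ is the disjoint union of the $V_i$ and every edge contains exactly one vertex of each $V_i$. $K_{s_1,\ldots,s_r}$ denotes the complete $r$-partite $r$-graph whose $i$-th part has $s_i$ vertices. $H$ contains an ordered $K_{s_1,\ldots,s_r}$ if there are sets $S_i\subseteq V_i$ with $|S_i|=s_i$ for $1\le i\le r$ such that $\{v_1,\ldots,v_r\}\in E(H)$ for all choices $v_i\in S_i$. The Zarankiewicz number $z(m_1,\ldots,m_r;s_1,\ldots,s_r)$ is the maximum number of edges of an $r$-partite $r$-graph whose $i$-th part has $m_i$ vertices ($1\le i\le r$) and which does not contain an ordered $K_{s_1,\ldots,s_r}$. In the claim this is used with $m_r=n$ and $s_r=t$. *)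

theory Defs
  imports Complex_Main "HOL-Library.Disjoint_Sets" "HOL-Library.FuncSet" "HOL-Library.Nat_Bijection"
begin

text \<open>Parts and their sizes are indexed by \<open>{1..r}\<close>; values of the functions \<open>V\<close>, \<open>m\<close>, \<open>s\<close> outside
  this range are irrelevant.\<close>

definition r_graph :: "nat \<Rightarrow> 'a set \<Rightarrow> 'a set set \<Rightarrow> bool" where
  "r_graph r X E \<longleftrightarrow> finite X \<and> (\<forall>e\<in>E. e \<subseteq> X \<and> card e = r)"

definition r_partite :: "nat \<Rightarrow> 'a set \<Rightarrow> 'a set set \<Rightarrow> (nat \<Rightarrow> 'a set) \<Rightarrow> bool" where
  "r_partite r X E V \<longleftrightarrow>
     X = (\<Union>i\<in>{1..r}. V i) \<and> disjoint_family_on V {1..r} \<and>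
     (\<forall>e\<in>E. \<forall>i\<in>{1..r}. \<exists>!v. v \<in> e \<inter> V i)"

definition contains_ordered_K :: "nat \<Rightarrow> 'a set set \<Rightarrow> (nat \<Rightarrow> 'a set) \<Rightarrow> (nat \<Rightarrow> nat) \<Rightarrow> bool" where
  "contains_ordered_K r E V s \<longleftrightarrow>
     (\<exists>S. (\<forall>i\<in>{1..r}. S i \<subseteq> V i \<and> card (S i) = s i) \<and>
          (\<forall>v \<in> Pi {1..r} S. v ` {1..r} \<in> E))"

text \<open>The vertices are taken to be natural numbers, which is no restriction: every finite \<open>r\<close>-graph
  is isomorphic to one with vertices in \<^typ>\<open>nat\<close>.\<close>

definition zarankiewicz_graph ::
    "nat \<Rightarrow> (nat \<Rightarrow> nat) \<Rightarrow> (nat \<Rightarrow> nat) \<Rightarrow> nat set \<Rightarrow> nat set set \<Rightarrow> (nat \<Rightarrow> nat set) \<Rightarrow> bool" where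
  "zarankiewicz_graph r m s X E V \<longleftrightarrow>
     r_graph r X E \<and> r_partite r X E V \<and> (\<forall>i\<in>{1..r}. card (V i) = m i) \<and>
     \<not> contains_ordered_K r E V s"

definition zarankiewicz :: "nat \<Rightarrow> (nat \<Rightarrow> nat) \<Rightarrow> (nat \<Rightarrow> nat) \<Rightarrow> nat" where
  "zarankiewicz r m s = Max {card E | X E V. zarankiewicz_graph r m s X E V}"

text \<open>The set in this definition is finite, and nonempty whenever the \<open>s i\<close> are positive, so
  that the maximum is attained.\<close>

lemma finite_zarankiewicz_set: "finite {card E | X E V. zarankiewicz_graph r m s X E V}"
proof (rule finite_subset)
  show "{card E | X E V. zarankiewicz_graph r m s X E V} \<subseteq> {..2 ^ (\<Sum>i\<in>{1..r}. m i)}"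
  proof safe
    fix X E V assume "zarankiewicz_graph r m s X E V"
    then have X: "finite X" "E \<subseteq> Pow X" "X = (\<Union>i\<in>{1..r}. V i)" "\<forall>i\<in>{1..r}. card (V i) = m i"
      unfolding zarankiewicz_graph_def r_graph_def r_partite_def by blast+
    have "card E \<le> card (Pow X)"
      using X by (intro card_mono) auto
    also have "\<dots> = 2 ^ card X"
      using X(1) by (rule card_Pow)
    also have "\<dots> \<le> 2 ^ (\<Sum>i\<in>{1..r}. m i)"
    proof (rule power_increasing)
      have "card X \<le> (\<Sum>i\<in>{1..r}. card (V i))"
        unfolding X(3) by (rule card_UN_le) simp
      also have "\<dots> = (\<Sum>i\<in>{1..r}. m i)"
        using X(4) by (intro sum.cong) auto
      finally show "card X \<le> (\<Sum>i\<in>{1..r}. m i)" .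
    qed simp
    finally show "card E \<le> 2 ^ (\<Sum>i\<in>{1..r}. m i)" .
  qed
qed simp

lemma zarankiewicz_set_nonempty:
  assumes "\<forall>i\<in>{1..r}. 0 < s i"
  shows "{card E | X E V. zarankiewicz_graph r m s X E V} \<noteq> {}"
proof -
  define V where "V i = (\<lambda>k. prod_encode (i, k)) ` {..<m i}" for i
  have c: "card (V i) = m i" for i
    unfolding V_def by (subst card_image) (auto simp: inj_on_def)
  have d: "disjoint_family_on V {1..r}"
    by (auto simp: disjoint_family_on_def V_def)
  have "\<not> contains_ordered_K r {} V s"
  proof
    assume "contains_ordered_K r {} V s"
    then obtain S where S: "\<forall>i\<in>{1..r}. S i \<subseteq> V i \<and> card (S i) = s i" "\<forall>v\<in>Pi {1..r} S. False"
      unfolding contains_ordered_K_def empty_iff by blast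
    have "\<forall>i\<in>{1..r}. S i \<noteq> {}"
      using S(1) assms by (metis card.empty less_irrefl)
    then have "(\<lambda>i. SOME x. x \<in> S i) \<in> Pi {1..r} S"
      by (simp add: Pi_def some_in_eq)
    then show False
      using S(2) by blast
  qed
  then have "zarankiewicz_graph r m s (\<Union>i\<in>{1..r}. V i) {} V"
    using c d by (simp add: zarankiewicz_graph_def r_graph_def r_partite_def V_def)
  then show ?thesis
    by blast
qed

end

theory Submission
  imports Defs "HOL-Library.Function_Algebras" "HOL-Library.Sublist" "HOL-Library.Z2"
    "HOL-Algebra.Algebraic_Closure_Type"
begin

text \<open>
  A subset of the product of the first \<open>r - 1\<close> parts of the form \<open>S\<^sub>1 \<times> \<dots> \<times> S\<^sub>r\<^sub>-\<^sub>1\<close> has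
  \<open>p = s\<^sub>1 \<cdots> s\<^sub>r\<^sub>-\<^sub>1\<close> elements, so a bipartite graph without an ordered \<open>K\<^sub>p\<^sub>,\<^sub>t\<close> yields the
  hypergraph. Put \<open>k = p - 1\<close>, choose \<open>d\<close> with \<open>d^k < t \<le> (d + 1)^k\<close>, and let \<open>F\<close> be a field with
  \<open>q\<close> elements, where \<open>q^p\<close> is about \<open>n\<close>. The left vertices are forms \<open>f\<close> of degree \<open>d\<close> in \<open>k + 1\<close>
  variables, and \<open>f\<close> is joined to the \<open>q^k\<close> points \<open>(z, f z)\<close> with \<open>z\<close> in the affine chart
  \<open>z\<^sub>0 = 1\<close>. The common neighbours of \<open>f\<^sub>0, \<dots>, f\<^sub>k\<close> correspond to the common zeros of
  \<open>f\<^sub>1 - f\<^sub>0, \<dots>, f\<^sub>k - f\<^sub>0\<close>. If these differences form a regular sequence, the Hilbert function of the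
  quotient bounds the number of zeros by \<open>d^k < t\<close>.

  Forms with regular differences are chosen greedily. Let \<open>g\<^sub>1, \<dots>, g\<^sub>j\<close> be completed by linear forms
  \<open>\<lambda>, \<mu>, \<dots>\<close> to a regular sequence of length \<open>k + 1\<close>. Modulo all of these except \<open>\<lambda>\<close> and \<open>\<mu>\<close>, every
  form \<open>g\<close> of degree \<open>d\<close> satisfies a nonzero relation \<open>\<Phi>(g) = 0\<close> of bounded degree over \<open>F[\<lambda>, \<mu>]\<close>.
  For a binary form \<open>b\<close> of degree \<open>d\<close> in \<open>\<lambda>, \<mu>\<close> with \<open>\<Phi>(- b) \<noteq> 0\<close>, some \<open>c \<in> F\<close> makes
  \<open>\<Phi>(- b)\<close> a nonzero multiple of a power of \<open>\<lambda>\<close> after the substitution \<open>\<mu> = c \<lambda>\<close>, and then \<open>g + b\<close>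
  and \<open>\<mu> - c \<lambda>\<close> can replace \<open>\<lambda>\<close> and \<open>\<mu>\<close>. As \<open>\<Phi>\<close> has boundedly many roots among the \<open>q^(d + 1)\<close>
  binary forms, only a fraction \<open>O(q^-(d + 1))\<close> of all forms is bad, so about \<open>q^((d + 1) / k)\<close> left
  vertices can be selected.
\<close>

hide_const (open) up_ring.monom up_ring.coeff Divisibility.prime Coset.order module.smult
  Polynomials.degree Polynomials.lead_coeff

section \<open>Graded ideals and regular sequences\<close>

text \<open>Degrees are integers, with nothing in negative degrees, so that degree shifts need no truncated
  subtraction. The map \<open>sc\<close> embeds the scalars.\<close>

locale graded_algebra =
  fixes G :: "int \<Rightarrow> 'r::comm_ring_1 set" and F :: "'a::field set" and sc :: "'a \<Rightarrow> 'r"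
  assumes finite_F: "finite F"
    and F_0: "0 \<in> F" and F_1: "1 \<in> F"
    and F_add: "\<And>a b. a \<in> F \<Longrightarrow> b \<in> F \<Longrightarrow> a + b \<in> F"
    and F_uminus: "\<And>a. a \<in> F \<Longrightarrow> - a \<in> F"
    and F_mult: "\<And>a b. a \<in> F \<Longrightarrow> b \<in> F \<Longrightarrow> a * b \<in> F"
    and F_inverse: "\<And>a. a \<in> F \<Longrightarrow> inverse a \<in> F"
    and sc_add: "\<And>a b. sc (a + b) = sc a + sc b"
    and sc_mult: "\<And>a b. sc (a * b) = sc a * sc b"
    and sc_1: "sc 1 = 1"
    and sc_G: "\<And>a. a \<in> F \<Longrightarrow> sc a \<in> G 0"
    and finite_G: "\<And>D. finite (G D)"
    and G_0: "\<And>D. 0 \<in> G D"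
    and G_add: "\<And>D u v. u \<in> G D \<Longrightarrow> v \<in> G D \<Longrightarrow> u + v \<in> G D"
    and G_uminus: "\<And>D u. u \<in> G D \<Longrightarrow> - u \<in> G D"
    and G_mult: "\<And>D e u v. u \<in> G D \<Longrightarrow> v \<in> G e \<Longrightarrow> u * v \<in> G (D + e)"
    and G_neg: "\<And>D. D < 0 \<Longrightarrow> G D = {0}"
begin

lemma sc_0: "sc 0 = 0"
  using sc_add[of 0 0] by simp

lemma sc_uminus: "sc (- a) = - sc a"
  using sc_add[of a "- a"] by (simp add: sc_0 add_eq_0_iff)

lemma sc_diff: "sc (a - b) = sc a - sc b"
  using sc_add[of a "- b"] by (simp add: sc_uminus)

lemma sc_sum: "sc (\<Sum>x\<in>A. f x) = (\<Sum>x\<in>A. sc (f x))"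
  by (induction A rule: infinite_finite_induct) (simp_all add: sc_0 sc_add)

lemma sc_power: "sc (a ^ n) = sc a ^ n"
  by (induction n) (simp_all add: sc_1 sc_mult)

lemma one_G: "1 \<in> G 0"
  using sc_G[OF F_1] by (simp add: sc_1)

lemma G_diff: "u \<in> G D \<Longrightarrow> v \<in> G D \<Longrightarrow> u - v \<in> G D"
  using G_add[of u D "- v"] G_uminus[of v D] by simp

lemma F_diff: "a \<in> F \<Longrightarrow> b \<in> F \<Longrightarrow> a - b \<in> F"
  using F_add[of a "- b"] F_uminus[of b] by simp

lemma G_sum: "(\<And>x. x \<in> A \<Longrightarrow> f x \<in> G D) \<Longrightarrow> (\<Sum>x\<in>A. f x) \<in> G D"
  by (induction A rule: infinite_finite_induct) (auto simp: G_0 G_add)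

lemma G_power: "u \<in> G D \<Longrightarrow> u ^ n \<in> G (int n * D)"
proof (induction n)
  case (Suc n)
  then show ?case using G_mult[of u D "u ^ n" "int n * D"] by (simp add: algebra_simps)
qed (simp add: one_G)

lemma G_sc_mult: "a \<in> F \<Longrightarrow> u \<in> G D \<Longrightarrow> sc a * u \<in> G D"
  using G_mult[OF sc_G, of a u D] by simp

lemma card_F: "1 < card F"
proof -
  have "card {0, 1::'a} \<le> card F"
    by (intro card_mono finite_F) (auto simp: F_0 F_1)
  then show ?thesis by simp
qed

section \<open>Homogeneous ideals and non-zero-divisors\<close>

definition gideal :: "(int \<Rightarrow> 'r set) \<Rightarrow> bool" where
  "gideal I \<longleftrightarrow> (\<forall>D. I D \<subseteq> G D \<and> 0 \<in> I D \<and> (\<forall>u\<in>I D. \<forall>v\<in>I D. u - v \<in> I D) \<and>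
     (\<forall>e. \<forall>f\<in>G e. \<forall>u\<in>I D. f * u \<in> I (e + D)))"

lemma gidealD:
  assumes "gideal I"
  shows gideal_G: "u \<in> I D \<Longrightarrow> u \<in> G D"
    and gideal_0: "0 \<in> I D"
    and gideal_diff: "u \<in> I D \<Longrightarrow> v \<in> I D \<Longrightarrow> u - v \<in> I D"
    and gideal_mult: "f \<in> G e \<Longrightarrow> u \<in> I D \<Longrightarrow> f * u \<in> I (e + D)"
  using assms unfolding gideal_def by auto

lemma gideal_uminus: "gideal I \<Longrightarrow> u \<in> I D \<Longrightarrow> - u \<in> I D"
  using gideal_diff[of I 0 D u] gideal_0[of I D] by simp

lemma gideal_add: "gideal I \<Longrightarrow> u \<in> I D \<Longrightarrow> v \<in> I D \<Longrightarrow> u + v \<in> I D"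
  using gideal_diff[of I u D "- v"] gideal_uminus[of I v D] by simp

lemma gideal_sum: "gideal I \<Longrightarrow> (\<And>x. x \<in> A \<Longrightarrow> f x \<in> I D) \<Longrightarrow> (\<Sum>x\<in>A. f x) \<in> I D"
  by (induction A rule: infinite_finite_induct) (auto simp: gideal_0 gideal_add)

lemma gideal_finite: "gideal I \<Longrightarrow> finite (I D)"
  by (rule finite_subset[OF _ finite_G[of D]]) (auto dest: gideal_G)

lemma gideal_card_pos: "gideal I \<Longrightarrow> 0 < card (I D)"
  using gideal_finite[of I D] gideal_0[of I D] by (auto simp: card_gt_0_iff)

lemma gideal_zero: "gideal (\<lambda>_. {0})"
  by (simp add: gideal_def G_0)

text \<open>The ideal generated by \<open>I\<close> and a form \<open>g\<close> of degree
  \<open>d\<close>; a single multiple of \<open>g\<close> suffices because \<open>I\<close> is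
  already an ideal.\<close>

definition adjoin :: "(int \<Rightarrow> 'r set) \<Rightarrow> 'r \<Rightarrow> int \<Rightarrow> int \<Rightarrow> 'r set" where
  "adjoin I g d D = {u + g * v | u v. u \<in> I D \<and> v \<in> G (D - d)}"

text \<open>That \<open>g\<close> is a non-zero-divisor modulo \<open>I\<close> need only be tested
  on homogeneous elements.\<close>

definition regular :: "(int \<Rightarrow> 'r set) \<Rightarrow> 'r \<Rightarrow> int \<Rightarrow> bool" where
  "regular I g d \<longleftrightarrow> (\<forall>D. \<forall>v\<in>G D. g * v \<in> I (D + d) \<longrightarrow> v \<in> I D)"

lemma adjoinI: "u \<in> I D \<Longrightarrow> v \<in> G (D - d) \<Longrightarrow> w = u + g * v \<Longrightarrow> w \<in> adjoin I g d D"
  unfolding adjoin_def by blast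

lemma adjoinE:
  assumes "w \<in> adjoin I g d D"
  obtains u v where "u \<in> I D" "v \<in> G (D - d)" "w = u + g * v"
  using assms unfolding adjoin_def by blast

lemma adjoin_superset: "u \<in> I D \<Longrightarrow> u \<in> adjoin I g d D"
  by (rule adjoinI[of u _ _ 0]) (auto simp: G_0)

lemma adjoin_generator: "gideal I \<Longrightarrow> g \<in> adjoin I g d d"
  by (rule adjoinI[of 0 _ _ 1]) (auto simp: one_G gideal_0)

lemma regularD: "regular I g d \<Longrightarrow> v \<in> G D \<Longrightarrow> g * v \<in> I (D + d) \<Longrightarrow> v \<in> I D"
  unfolding regular_def by blast

lemma gideal_adjoin:
  assumes I: "gideal I" and g: "g \<in> G d"
  shows "gideal (adjoin I g d)"
  unfolding gideal_def
proof (intro allI conjI ballI subsetI)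
  fix D u assume "u \<in> adjoin I g d D"
  then show "u \<in> G D"
    using gideal_G[OF I] G_mult[OF g] by (force elim!: adjoinE intro!: G_add)
next
  fix D show "0 \<in> adjoin I g d D"
    by (intro adjoin_superset gideal_0 I)
next
  fix D u v assume "u \<in> adjoin I g d D" "v \<in> adjoin I g d D"
  then obtain a b a' b' where "a \<in> I D" "a' \<in> I D" "b \<in> G (D - d)" "b' \<in> G (D - d)"
    "u = a + g * b" "v = a' + g * b'"
    by (elim adjoinE) blast
  then show "u - v \<in> adjoin I g d D"
    by (intro adjoinI[of "a - a'" _ _ "b - b'"]) (auto intro: gideal_diff[OF I] G_diff simp: algebra_simps)
next
  fix D e f u assume f: "f \<in> G e" and "u \<in> adjoin I g d D"
  then obtain a b where "a \<in> I D" "b \<in> G (D - d)" "u = a + g * b"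
    by (elim adjoinE) blast
  moreover have "f * b \<in> G (e + D - d)" if "b \<in> G (D - d)"
    using G_mult[OF f that] by (simp add: algebra_simps)
  ultimately show "f * u \<in> adjoin I g d (e + D)"
    by (intro adjoinI[of "f * a" _ _ "f * b"] gideal_mult[OF I f]) (auto simp: algebra_simps)
qed

lemma adjoin_commute: "adjoin (adjoin I g d) h e = adjoin (adjoin I h e) g d"
proof -
  have "adjoin (adjoin I g d) h e D \<subseteq> adjoin (adjoin I h e) g d D" for g d h e D
  proof
    fix x assume "x \<in> adjoin (adjoin I g d) h e D"
    then obtain u v w where "u \<in> I D" "v \<in> G (D - d)" "w \<in> G (D - e)" "x = u + g * v + h * w"
      by (elim adjoinE) blast
    then show "x \<in> adjoin (adjoin I h e) g d D"
      by (intro adjoinI[of "u + h * w" _ _ v] adjoinI[of u _ _ w]) auto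
  qed
  then show ?thesis by blast
qed

text \<open>The first part is a descent on the degree, which is bounded below.\<close>

lemma regular_swap:
  assumes I: "gideal I" and a: "a \<in> G d" "0 < d" and b: "b \<in> G e" "0 < e"
    and ra: "regular I a d" and rb: "regular (adjoin I a d) b e"
  shows "regular I b e" "regular (adjoin I b e) a d"
proof -
  have *: "\<forall>v\<in>G D. b * v \<in> I (D + e) \<longrightarrow> v \<in> I D" for D
  proof (induction "nat (D + 1)" arbitrary: D rule: less_induct)
    case less
    show ?case
    proof (intro ballI impI)
      fix v assume v: "v \<in> G D" "b * v \<in> I (D + e)"
      show "v \<in> I D"
      proof (cases "D < 0")
        case True
        then show ?thesis using v G_neg gideal_0[OF I] by auto
      next
        case False
        \<comment> \<open>Regularity of \<open>b\<close> modulo \<open>a\<close> gives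
          \<open>v = u + a * w\<close>; then \<open>b * w\<close> lies in \<open>I\<close> again,
          with \<open>w\<close> of smaller degree.\<close>
        have "v \<in> adjoin I a d D"
          using v by (auto intro: regularD[OF rb v(1)] adjoin_superset)
        then obtain u w where u: "u \<in> I D" "w \<in> G (D - d)" "v = u + a * w"
          by (elim adjoinE)
        have "a * (b * w) = b * v - b * u"
          using u by (simp add: algebra_simps)
        also have "\<dots> \<in> I (D + e)"
          using gideal_mult[OF I b(1) u(1)] v(2) by (intro gideal_diff[OF I]) (simp_all add: add.commute)
        finally have "b * w \<in> I (D - d + e)"
          using G_mult[OF b(1) u(2)]
          by (intro regularD[OF ra, of "b * w"]) (simp_all add: add.commute)
        then have "w \<in> I (D - d)"
          using less[of "D - d"] False a(2) u(2) by auto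
        from gideal_mult[OF I a(1) this] have "a * w \<in> I D" by simp
        then show ?thesis unfolding u(3) by (intro gideal_add[OF I u(1)])
      qed
    qed
  qed
  then show "regular I b e" unfolding regular_def by blast
  show "regular (adjoin I b e) a d"
    unfolding regular_def
  proof (intro allI ballI impI)
    fix D v assume v: "v \<in> G D" "a * v \<in> adjoin I b e (D + d)"
    then obtain u w where u: "u \<in> I (D + d)" "w \<in> G (D + d - e)" "a * v = u + b * w"
      by (elim adjoinE)
    \<comment> \<open>Read modulo \<open>a\<close>, this relation shows that \<open>w\<close> is a
      multiple of \<open>a\<close> up to \<open>I\<close>; the factor \<open>a\<close> can then be
      cancelled.\<close>
    have "b * w = - u + a * v" using u by simp
    then have "b * w \<in> adjoin I a d (D + d)"
      using u v by (intro adjoinI[of "- u" _ _ v]) (auto simp: gideal_uminus[OF I])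
    then have "w \<in> adjoin I a d (D + d - e)"
      using u(2) by (intro regularD[OF rb, of w]) auto
    then obtain u' w' where u': "u' \<in> I (D + d - e)" "w' \<in> G (D + d - e - d)" "w = u' + a * w'"
      by (elim adjoinE)
    have "D + d - e - d = D - e" by simp
    then have w': "w' \<in> G (D - e)" using u'(2) by simp
    have "a * (v - b * w') = u + b * u'"
      using u u' by (simp add: algebra_simps)
    also have "\<dots> \<in> I (D + d)"
      using u(1) gideal_mult[OF I b(1) u'(1)] by (intro gideal_add[OF I]) simp_all
    finally have "v - b * w' \<in> I D"
      using v(1) G_mult[OF b(1) w'] by (intro regularD[OF ra, of "v - b * w'"] G_diff) simp_all
    then show "v \<in> adjoin I b e D"
      using w' by (intro adjoinI[of "v - b * w'" _ _ w']) auto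
  qed
qed

section \<open>Permutation invariance of regular sequences\<close>

fun adjoin_list :: "(int \<Rightarrow> 'r set) \<Rightarrow> ('r \<times> int) list \<Rightarrow> int \<Rightarrow> 'r set" where
  "adjoin_list I [] = I"
| "adjoin_list I ((g, d) # xs) = adjoin_list (adjoin I g d) xs"

fun regseq :: "(int \<Rightarrow> 'r set) \<Rightarrow> ('r \<times> int) list \<Rightarrow> bool" where
  "regseq I [] \<longleftrightarrow> True"
| "regseq I ((g, d) # xs) \<longleftrightarrow> g \<in> G d \<and> 0 < d \<and> regular I g d \<and> regseq (adjoin I g d) xs"

lemma adjoin_list_append: "adjoin_list I (xs @ ys) = adjoin_list (adjoin_list I xs) ys"
  by (induction I xs rule: adjoin_list.induct) auto

lemma regseq_append: "regseq I (xs @ ys) \<longleftrightarrow> regseq I xs \<and> regseq (adjoin_list I xs) ys"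
  by (induction I xs rule: regseq.induct) auto

lemma gideal_adjoin_list: "gideal I \<Longrightarrow> regseq I xs \<Longrightarrow> gideal (adjoin_list I xs)"
  by (induction I xs rule: regseq.induct) (auto intro: gideal_adjoin)

lemma adjoin_list_front: "adjoin_list I (xs @ x # ys) = adjoin_list I (x # xs @ ys)"
proof (induction I xs rule: adjoin_list.induct)
  case (2 I g d xs)
  then show ?case by (cases x) (auto simp: adjoin_commute)
qed auto

text \<open>By induction \<open>x\<close> already stands first modulo \<open>g\<close>, and
  \<open>regular_swap\<close> carries it past \<open>g\<close>. The positive degrees demanded by
  \<open>regseq\<close> make the descent there possible.\<close>

lemma regseq_front: "gideal I \<Longrightarrow> regseq I (xs @ x # ys) \<Longrightarrow> regseq I (x # xs @ ys)"
proof (induction I xs rule: adjoin_list.induct)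
  case (2 I g d xs)
  obtain h e where x: "x = (h, e)" by (cases x)
  from 2 have "regseq (adjoin I g d) (x # xs @ ys)" "g \<in> G d" "0 < d" "regular I g d"
    by (auto intro: gideal_adjoin)
  then show ?case
    using regular_swap[OF 2(2), of g d h e] by (auto simp: x adjoin_commute)
qed auto

lemma adjoin_list_perm: "mset xs = mset ys \<Longrightarrow> adjoin_list I xs = adjoin_list I ys"
proof (induction ys arbitrary: I xs)
  case (Cons y ys)
  then have "y \<in> set xs" by (metis list.set_intros(1) set_mset_mset)
  then obtain us vs where xs: "xs = us @ y # vs" by (auto simp: in_set_conv_decomp)
  then have "mset (us @ vs) = mset ys" using Cons by simp
  from Cons.IH[OF this] show ?case
    unfolding xs adjoin_list_front by (cases y) simp
qed auto

lemma regseq_perm: "mset xs = mset ys \<Longrightarrow> gideal I \<Longrightarrow> regseq I xs \<Longrightarrow> regseq I ys"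
proof (induction ys arbitrary: I xs)
  case (Cons y ys)
  then have "y \<in> set xs" by (metis list.set_intros(1) set_mset_mset)
  then obtain us vs where xs: "xs = us @ y # vs" by (auto simp: in_set_conv_decomp)
  then have *: "mset (us @ vs) = mset ys" using Cons by simp
  from Cons have "regseq I (y # us @ vs)" unfolding xs by (intro regseq_front)
  then show ?case
    using Cons.IH[OF *] Cons.prems(2) by (cases y) (auto intro: gideal_adjoin)
qed auto

section \<open>Hilbert functions of quotients\<close>

text \<open>The dimension over \<open>F\<close> of the quotient in degree \<open>D\<close>, expressed through cardinalities.\<close>

definition hilb :: "(int \<Rightarrow> 'r set) \<Rightarrow> int \<Rightarrow> real" where
  "hilb I D = log (card F) (card (G D) / card (I D))"

lemma card_G_pos: "0 < card (G D)"
  using finite_G[of D] G_0[of D] by (auto simp: card_gt_0_iff)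

lemma hilb_nonneg: "gideal I \<Longrightarrow> 0 \<le> hilb I D"
proof -
  assume I: "gideal I"
  have "card (I D) \<le> card (G D)"
    by (intro card_mono finite_G subsetI gideal_G[OF I])
  then have "1 \<le> real (card (G D)) / real (card (I D))"
    using gideal_card_pos[OF I, of D] by (simp add: field_simps)
  then show ?thesis
    unfolding hilb_def using card_F by (subst zero_le_log_cancel_iff) auto
qed

lemma hilb_neg: "gideal I \<Longrightarrow> D < 0 \<Longrightarrow> hilb I D = 0"
proof -
  assume I: "gideal I" "D < 0"
  then have "I D = {0}" using gideal_G[OF I(1), of _ D] gideal_0[OF I(1), of D] G_neg[of D] by auto
  then show ?thesis using I(2) by (simp add: hilb_def G_neg)
qed

text \<open>The map sending \<open>(u, v)\<close> to \<open>u + g * v\<close> takes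
  \<open>I D \<times> G (D - d)\<close> onto the component of the larger ideal, and by regularity
  its kernel is parametrised by \<open>I (D - d)\<close>.\<close>

lemma card_adjoin:
  assumes I: "gideal I" and g: "g \<in> G d" and r: "regular I g d"
  shows "card (I D) * card (G (D - d)) = card (adjoin I g d D) * card (I (D - d))"
proof -
  have "\<forall>y\<in>adjoin I g d D. \<exists>p. fst p \<in> I D \<and> snd p \<in> G (D - d) \<and> fst p + g * snd p = y"
    by (metis adjoinE fst_conv snd_conv)
  from bchoice[OF this] obtain p where p: "\<And>y. y \<in> adjoin I g d D \<Longrightarrow>
      fst (p y) \<in> I D \<and> snd (p y) \<in> G (D - d) \<and> fst (p y) + g * snd (p y) = y"
    by blast
  \<comment> \<open>The section \<open>p\<close> picks one preimage of each \<open>y\<close>;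
    \<open>f\<close> translates it by the kernel elements \<open>(- (g * w), w)\<close>.\<close>
  define f where "f = (\<lambda>(y, w). (fst (p y) - g * w, snd (p y) + w))"
  have gw: "g * w \<in> I D" if "w \<in> I (D - d)" for w
    using gideal_mult[OF I g that] by simp
  have "bij_betw f (adjoin I g d D \<times> I (D - d)) (I D \<times> G (D - d))"
  proof (rule bij_betw_imageI)
    show "inj_on f (adjoin I g d D \<times> I (D - d))"
    proof (rule inj_onI)
      fix x x' assume x: "x \<in> adjoin I g d D \<times> I (D - d)" "x' \<in> adjoin I g d D \<times> I (D - d)" "f x = f x'"
      have *: "fst (f z) + g * snd (f z) = fst z" if "z \<in> adjoin I g d D \<times> I (D - d)" for z
      proof -
        have "fst (f z) + g * snd (f z) = fst (p (fst z)) + g * snd (p (fst z))"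
          by (simp add: f_def algebra_simps split: prod.splits)
        also have "\<dots> = fst z" using p[of "fst z"] that by auto
        finally show ?thesis .
      qed
      have "fst x = fst x'" using *[of x] *[of x'] x by simp
      with x(3) show "x = x'" by (auto simp: f_def prod_eq_iff split: prod.splits)
    qed
    show "f ` (adjoin I g d D \<times> I (D - d)) = I D \<times> G (D - d)"
    proof (intro equalityI subsetI)
      fix x assume "x \<in> f ` (adjoin I g d D \<times> I (D - d))"
      then show "x \<in> I D \<times> G (D - d)"
        using p gw by (auto simp: f_def intro: gideal_diff[OF I] G_add dest: gideal_G[OF I])
    next
      fix x assume "x \<in> I D \<times> G (D - d)"
      then obtain u v where x: "x = (u, v)" "u \<in> I D" "v \<in> G (D - d)" by auto
      define y where "y = u + g * v"
      have y: "y \<in> adjoin I g d D" using x by (auto simp: y_def intro: adjoinI)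
      note py = p[OF y]
      have e: "g * (v - snd (p y)) = fst (p y) - u"
        using py by (simp add: y_def algebra_simps)
      also have "\<dots> \<in> I (D - d + d)" using py x gideal_diff[OF I] by simp
      finally have "v - snd (p y) \<in> I (D - d)"
        using x py by (intro regularD[OF r, of "v - snd (p y)"]) (auto intro: G_diff)
      moreover have "f (y, v - snd (p y)) = x"
        using e by (simp add: f_def x)
      ultimately show "x \<in> f ` (adjoin I g d D \<times> I (D - d))"
        using y by (intro image_eqI[of _ _ "(y, v - snd (p y))"]) auto
    qed
  qed
  from bij_betw_same_card[OF this] show ?thesis
    by (simp add: card_cartesian_product)
qed

lemma hilb_adjoin:
  assumes I: "gideal I" and g: "g \<in> G d" and r: "regular I g d"
  shows "hilb (adjoin I g d) D = hilb I D - hilb I (D - d)"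
proof -
  note pos = gideal_card_pos[OF I] gideal_card_pos[OF gideal_adjoin[OF I g]] card_G_pos
  have "real (card (I D)) * real (card (G (D - d))) = real (card (adjoin I g d D)) * real (card (I (D - d)))"
    using card_adjoin[OF assms, of D] by (metis of_nat_mult)
  then have "real (card (G D)) / real (card (adjoin I g d D)) =
      (card (G D) / card (I D)) / (card (G (D - d)) / card (I (D - d)))"
    using pos[of D] pos[of "D - d"] by (simp add: field_simps)
  then show ?thesis
    unfolding hilb_def using pos[of D] pos[of "D - d"] card_F by (simp add: log_divide log_mult)
qed

text \<open>A shift by \<open>d\<close> is split into \<open>d\<close> unit shifts; each of these
  sums telescopes to its top term, since \<open>f\<close> vanishes below zero.\<close>

lemma sum_shift_diff:
  fixes f :: "int \<Rightarrow> real"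
  assumes "\<And>i. i < 0 \<Longrightarrow> f i = 0"
  shows "(\<Sum>i\<in>{0..int M}. f i - f (i - int d)) = (\<Sum>t<d. f (int M - int t))"
proof -
  have one: "(\<Sum>i\<in>{0..int M}. f (i - int t) - f (i - int t - 1)) = f (int M - int t)" for t
  proof (induction M)
    case (Suc M)
    have "{0..int (Suc M)} = insert (int (Suc M)) {0..int M}" by auto
    then show ?case using Suc by simp
  qed (use assms in auto)
  have tel: "f i - f (i - int d) = (\<Sum>t<d. f (i - int t) - f (i - int t - 1))" for i
    by (induction d) (auto simp: algebra_simps)
  show ?thesis
    unfolding tel by (subst sum.swap) (simp add: one)
qed

lemma sum_hilb_adjoin:
  assumes I: "gideal I" and g: "g \<in> G (int d)" and r: "regular I g (int d)"
  shows "(\<Sum>i\<in>{0..int M}. hilb (adjoin I g (int d)) i) = (\<Sum>t<d. hilb I (int M - int t))"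
  unfolding hilb_adjoin[OF assms] by (rule sum_shift_diff) (rule hilb_neg[OF I])

lemma hilb_eq_sum_adjoin:
  assumes "gideal I" "g \<in> G 1" "regular I g 1"
  shows "hilb I (int M) = (\<Sum>i\<in>{0..int M}. hilb (adjoin I g 1) i)"
  using sum_hilb_adjoin[of I g 1 M] assms by simp

text \<open>By \<open>hilb_eq_sum_adjoin\<close>, a bound on the total dimension of the quotient by
  one further linear form bounds the Hilbert function before that form is adjoined.\<close>

lemma hilb_le_of_adjoin:
  assumes "gideal I" "g \<in> G 1" "regular I g 1"
    and "\<And>M. (\<Sum>i\<in>{0..int M}. hilb (adjoin I g 1) i) \<le> W"
  shows "hilb I D \<le> W"
proof (cases "D < 0")
  case True
  \<comment> \<open>In negative degree only \<open>0 \<le> W\<close> is needed, and the sum for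
    \<open>M = 0\<close> provides it.\<close>
  have "0 \<le> (\<Sum>i\<in>{0..int 0}. hilb (adjoin I g 1) i)"
    by (intro sum_nonneg hilb_nonneg gideal_adjoin assms)
  also have "\<dots> \<le> W" by (rule assms)
  finally show ?thesis using True by (simp add: hilb_neg assms)
next
  case False
  then obtain M where "D = int M" using nonneg_int_cases[of D] by auto
  then show ?thesis using hilb_eq_sum_adjoin[OF assms(1-3)] assms(4) by simp
qed

section \<open>Extending a regular sequence\<close>

definition polys :: "nat \<Rightarrow> 'a poly set" where
  "polys n = {p. degree p \<le> n \<and> (\<forall>i. coeff p i \<in> F)}"

lemma polys_0: "polys 0 = (\<lambda>a. [:a:]) ` F"
proof -
  have "p \<in> (\<lambda>a. [:a:]) ` F" if p: "degree p = 0" "\<forall>i. coeff p i \<in> F" for p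
  proof -
    from p(1) obtain a where "p = [:a:]" by (rule degree_eq_zeroE)
    moreover from this have "a \<in> F" using p(2)[rule_format, of 0] by simp
    ultimately show ?thesis by blast
  qed
  then show ?thesis by (auto simp: polys_def coeff_pCons F_0 split: nat.splits)
qed

lemma polys_Suc: "polys (Suc n) = (\<lambda>(a, p). pCons a p) ` (F \<times> polys n)"
proof -
  have "p \<in> (\<lambda>(a, p). pCons a p) ` (F \<times> polys n)" if p: "p \<in> polys (Suc n)" for p
  proof -
    obtain a p' where p': "p = pCons a p'" by (cases p)
    have "degree p' \<le> n" using p unfolding p' polys_def by (simp split: if_splits)
    moreover have "coeff p' i \<in> F" for i
      using p unfolding p' polys_def by (auto dest!: spec[of _ "Suc i"])
    moreover have "a \<in> F" using p unfolding p' polys_def by (auto dest!: spec[of _ 0])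
    ultimately show ?thesis unfolding p' by (force simp: polys_def)
  qed
  moreover have "pCons a p \<in> polys (Suc n)" if "a \<in> F" "p \<in> polys n" for a p
    using that by (auto simp: polys_def coeff_pCons split: nat.splits)
  ultimately show ?thesis by auto
qed

lemma card_polys: "finite (polys n) \<and> card (polys n) = card F ^ (n + 1)"
proof (induction n)
  case 0
  then show ?case by (simp add: polys_0 finite_F card_image inj_on_def)
next
  case (Suc n)
  have "inj_on (\<lambda>(a, p). pCons a p) (F \<times> polys n)" by (auto simp: inj_on_def)
  with Suc show ?case
    by (simp add: polys_Suc finite_F card_image card_cartesian_product)
qed

lemma polys_diff: "p \<in> polys n \<Longrightarrow> p' \<in> polys n \<Longrightarrow> p - p' \<in> polys n"
  by (auto simp: polys_def F_diff intro: degree_diff_le)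

lemma F_power: "a \<in> F \<Longrightarrow> a ^ n \<in> F"
  by (induction n) (auto simp: F_1 F_mult)

lemma F_sum: "(\<And>x. x \<in> A \<Longrightarrow> f x \<in> F) \<Longrightarrow> sum f A \<in> F"
  by (induction A rule: infinite_finite_induct) (auto simp: F_0 F_add)

lemma polys_poly: "p \<in> polys n \<Longrightarrow> c \<in> F \<Longrightarrow> poly p c \<in> F"
  unfolding poly_altdef by (intro F_sum F_mult F_power) (auto simp: polys_def)

text \<open>The homogenisation of a polynomial \<open>b\<close> of degree at most \<open>d\<close>,
  formally \<open>u^d b(w/u)\<close>. Binary forms thus become univariate polynomials, whose roots
  can be counted.\<close>

definition bform :: "'r \<Rightarrow> 'r \<Rightarrow> nat \<Rightarrow> 'a poly \<Rightarrow> 'r" where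
  "bform u w d b = (\<Sum>a\<le>d. sc (coeff b a) * (u ^ (d - a) * w ^ a))"

lemma bform_G:
  assumes "u \<in> G 1" "w \<in> G 1" "\<And>i. coeff b i \<in> F"
  shows "bform u w d b \<in> G (int d)"
  unfolding bform_def
proof (rule G_sum)
  fix a assume "a \<in> {..d}"
  then have "u ^ (d - a) * w ^ a \<in> G (int d)"
    using G_mult[OF G_power[OF assms(1), of "d - a"] G_power[OF assms(2), of a]] by simp
  then show "sc (coeff b a) * (u ^ (d - a) * w ^ a) \<in> G (int d)"
    by (intro G_sc_mult assms)
qed

lemma bform_diff: "bform u w d (p - p') = bform u w d p - bform u w d p'"
  by (simp add: bform_def sc_diff algebra_simps sum_subtractf)

text \<open>The extra factor \<open>w\<close> serves the induction: one factor \<open>u\<close> is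
  moved into it, and the remaining error is a multiple of \<open>u - v\<close>.\<close>

lemma cong_power_mult:
  assumes I: "gideal I" and uv: "u - v \<in> I e" "u \<in> G e" "v \<in> G e"
  shows "w \<in> G m \<Longrightarrow> w * (u ^ n - v ^ n) \<in> I (m + int n * e)"
proof (induction n arbitrary: w m)
  case 0
  then show ?case by (simp add: gideal_0[OF I])
next
  case (Suc n)
  have "(w * u) * (u ^ n - v ^ n) \<in> I (m + e + int n * e)"
    by (intro Suc.IH G_mult Suc.prems uv)
  moreover have "(w * v ^ n) * (u - v) \<in> I (m + int n * e + e)"
    by (intro gideal_mult[OF I] G_mult Suc.prems G_power uv)
  ultimately have "(w * u) * (u ^ n - v ^ n) + (w * v ^ n) * (u - v) \<in> I (m + int (Suc n) * e)"
    by (intro gideal_add[OF I]) (simp_all add: algebra_simps)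
  then show ?case by (simp add: algebra_simps)
qed

lemma poly_sum_upto: "degree p \<le> n \<Longrightarrow> poly p x = (\<Sum>i\<le>n. coeff p i * x ^ i)" for p :: "'a poly"
  unfolding poly_altdef by (rule sum.mono_neutral_left) (auto simp: coeff_eq_0)

text \<open>Substituting \<open>w = c * u\<close> in \<open>u^d p(w/u)\<close> leaves
  \<open>p(c) u^d\<close>.\<close>

lemma bform_cong:
  assumes I: "gideal I" and u: "u \<in> G 1" "w \<in> G 1" "w - sc c * u \<in> I 1" and c: "c \<in> F"
    and p: "p \<in> polys n" "n \<le> d"
  shows "bform u w d p - sc (poly p c) * u ^ d \<in> I (int d)"
proof -
  have p': "degree p \<le> d" "\<And>i. coeff p i \<in> F" using p by (auto simp: polys_def)
  have *: "u ^ d = u ^ (d - a) * u ^ a" if "a \<le> d" for a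
    using that by (simp flip: power_add)
  have "bform u w d p - sc (poly p c) * u ^ d =
      (\<Sum>a\<le>d. (sc (coeff p a) * u ^ (d - a)) * (w ^ a - (sc c * u) ^ a))"
    unfolding poly_sum_upto[OF p'(1)] bform_def sc_sum sum_distrib_right sum_subtractf[symmetric]
    by (intro sum.cong) (auto simp: * sc_mult sc_power power_mult_distrib algebra_simps)
  also have "\<dots> \<in> I (int d)"
  proof (rule gideal_sum[OF I])
    fix a assume a: "a \<in> {..d}"
    have "(sc (coeff p a) * u ^ (d - a)) * (w ^ a - (sc c * u) ^ a) \<in> I (int (d - a) * 1 + int a * 1)"
      by (intro cong_power_mult[OF I] u G_sc_mult c p' G_power)
    then show "(sc (coeff p a) * u ^ (d - a)) * (w ^ a - (sc c * u) ^ a) \<in> I (int d)"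
      using a by simp
  qed
  finally show ?thesis .
qed

text \<open>Pigeonhole: there are more coefficient vectors than residue classes modulo \<open>J\<close> in degree \<open>D\<close>.\<close>

lemma exists_relation:
  assumes J: "gideal J" and u: "u \<in> G 1" "w \<in> G 1" and g: "g \<in> G (int d)"
    and D: "E + d * W \<le> D" and h: "hilb J (int D) < real ((E + 1) * (W + 1))"
  shows "\<exists>C. (\<forall>e\<le>W. C e \<in> polys E) \<and> (\<exists>e\<le>W. C e \<noteq> 0) \<and>
    (\<Sum>e\<le>W. bform u w (D - d * e) (C e) * g ^ e) \<in> J (int D)"
proof -
  \<comment> \<open>The number of free coefficients: \<open>W + 1\<close> polynomials with
    \<open>E + 1\<close> coefficients each.\<close>
  define N where "N = (E + 1) * (W + 1)"
  define A where "A = PiE {..W} (\<lambda>_. polys E)"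
  define \<psi> where "\<psi> C = (\<Sum>e\<le>W. bform u w (D - d * e) (C e) * g ^ e)" for C
  have cA: "card A = card F ^ N"
    unfolding A_def N_def using card_polys[of E] by (simp add: card_PiE power_mult[symmetric] del: power_Suc)
  have "real (card (G D)) / real (card (J D)) < card F powr N"
    using h card_F card_G_pos[of D] gideal_card_pos[OF J, of D] unfolding hilb_def N_def
    by (subst (asm) log_less_iff) auto
  then have lt: "card (G D) < card A * card (J D)"
    using card_F gideal_card_pos[OF J, of D] unfolding cA
    by (simp add: powr_realpow field_simps flip: of_nat_power of_nat_mult)
  have \<psi>G: "\<psi> C \<in> G D" if C: "C \<in> A" for C
    unfolding \<psi>_def
  proof (rule G_sum)
    fix e assume e: "e \<in> {..W}"
    then have "d * e \<le> D" using D by (metis atMost_iff le_add2 le_trans mult_le_mono2)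
    moreover have "bform u w (D - d * e) (C e) * g ^ e \<in> G (int (D - d * e) + int e * int d)"
      using C e by (intro G_mult bform_G u G_power g) (auto simp: A_def polys_def PiE_def)
    ultimately show "bform u w (D - d * e) (C e) * g ^ e \<in> G D"
      by (simp add: of_nat_diff algebra_simps)
  qed
  \<comment> \<open>A collision of pairs yields two distinct coefficient families whose values agree
    modulo \<open>J\<close>; their difference is the relation.\<close>
  have "\<not> inj_on (\<lambda>(C, v). \<psi> C + v) (A \<times> J D)"
  proof
    assume "inj_on (\<lambda>(C, v). \<psi> C + v) (A \<times> J D)"
    then have "card (A \<times> J D) \<le> card (G D)"
      using \<psi>G gideal_G[OF J] by (intro card_inj_on_le[OF _ _ finite_G]) (auto intro: G_add)
    then show False using lt by (simp add: card_cartesian_product)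
  qed
  then obtain C C' v v' where C: "C \<in> A" "C' \<in> A" "v \<in> J D" "v' \<in> J D"
    "\<psi> C + v = \<psi> C' + v'" "C \<noteq> C' \<or> v \<noteq> v'"
    unfolding inj_on_def by auto
  then have ne: "C \<noteq> C'" by auto
  define B where "B e = C e - C' e" for e
  have "\<exists>e\<le>W. B e \<noteq> 0"
  proof (rule ccontr)
    assume "\<not> ?thesis"
    then have "C = C'" using C(1,2) unfolding A_def by (intro PiE_ext[of C _ _ C']) (auto simp: B_def)
    with ne show False by simp
  qed
  moreover have "\<psi> C - \<psi> C' = v' - v" using C(5) by (simp add: algebra_simps)
  then have "\<psi> B \<in> J D"
    using gideal_diff[OF J C(4,3)]
    by (simp add: \<psi>_def B_def bform_diff left_diff_distrib sum_subtractf)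
  moreover have "B e \<in> polys E" if "e \<le> W" for e
    using C(1,2) that unfolding A_def B_def by (intro polys_diff) (auto simp: PiE_def)
  ultimately show ?thesis unfolding \<psi>_def by blast
qed

section \<open>Trading a linear form for a form of degree \<open>d\<close>\<close>

lemma regular_cong:
  assumes I: "gideal I" and "u - v \<in> I d"
  shows "regular I u d \<longleftrightarrow> regular I v d"
proof -
  have "regular I v d" if "regular I u d" and uv: "u - v \<in> I d" for u v
    unfolding regular_def
  proof (intro allI ballI impI)
    fix D x assume x: "x \<in> G D" "v * x \<in> I (D + d)"
    have "u * x = v * x + x * (u - v)" by (simp add: algebra_simps)
    also have "\<dots> \<in> I (D + d)"
      using x gideal_mult[OF I x(1) uv] by (intro gideal_add[OF I])
    finally show "x \<in> I D" using regularD[OF that(1) x(1)] by simp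
  qed
  from this[of u v] this[of v u] show ?thesis
    using assms(2) gideal_uminus[OF I assms(2)] by auto
qed

lemma adjoin_cong:
  assumes I: "gideal I" and uv: "u - v \<in> I d"
  shows "adjoin I u d = adjoin I v d"
proof -
  have "adjoin I u d D \<subseteq> adjoin I v d D" if "u - v \<in> I d" for u v D
  proof
    fix x assume "x \<in> adjoin I u d D"
    then obtain a b where ab: "a \<in> I D" "b \<in> G (D - d)" "x = a + u * b" by (elim adjoinE)
    have "b * (u - v) \<in> I D" using gideal_mult[OF I ab(2) that] by simp
    then show "x \<in> adjoin I v d D"
      by (intro adjoinI[of "a + b * (u - v)" _ _ b] gideal_add[OF I ab(1)])
         (simp_all add: ab(2,3) algebra_simps)
  qed
  from this[of u v] this[of v u] show ?thesis
    using uv gideal_uminus[OF I uv] by (auto simp: fun_eq_iff)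
qed

lemma exists_nonroot:
  assumes "p \<noteq> 0" "degree p < card F"
  shows "\<exists>c\<in>F. poly p c \<noteq> 0"
proof (rule ccontr)
  assume "\<not> ?thesis"
  then have "card F \<le> card {x. poly p x = 0}"
    by (intro card_mono poly_roots_finite assms) auto
  also have "\<dots> \<le> degree p" by (rule card_poly_roots_bound) (rule assms)
  finally show False using assms by simp
qed

text \<open>Modulo \<open>g\<close>, \<open>mu - c * lam\<close> and \<open>rest\<close>, the form
  \<open>g0\<close> becomes \<open>- b(c) lam^d\<close>, so the relation turns into a nonzero scalar
  times \<open>lam^D\<close>. Hence \<open>lam^D\<close> lies in this ideal, and as
  \<open>lam\<close> is regular modulo \<open>rest\<close> and \<open>mu - c * lam\<close>, so is
  \<open>g\<close>.\<close>

lemma extend_regseq: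
  assumes I: "gideal I" and rs: "regseq I ((lam, 1) # (mu, 1) # rest)"
    and W: "\<And>M. (\<Sum>i\<in>{0..int M}. hilb (adjoin_list I ((lam, 1) # (mu, 1) # rest)) i) \<le> real W"
    and g0: "g0 \<in> G (int d)" and d: "0 < d"
    and D: "D = E + d * W" "D < card F"
    and C: "\<And>e. e \<le> W \<Longrightarrow> C e \<in> polys E"
    and rel: "(\<Sum>e\<le>W. bform lam mu (D - d * e) (C e) * g0 ^ e) \<in> adjoin_list I rest (int D)"
    and b: "b \<in> polys d" and nz: "poly (\<Sum>e\<le>W. monom (C e) e) (- b) \<noteq> 0"
    and g: "g = g0 + bform lam mu d b"
  shows "\<exists>c\<in>F. regseq I ((g, int d) # (mu - sc c * lam, 1) # rest) \<and>
    (\<forall>M. (\<Sum>i\<in>{0..int M}. hilb (adjoin_list I ((g, int d) # (mu - sc c * lam, 1) # rest)) i) \<le> real (d * W))"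
proof -
  \<comment> \<open>The relation evaluated at \<open>- b\<close>, in dehomogenised form. Its degree
    is at most \<open>D\<close>, below \<open>card F\<close>, so \<open>F\<close> contains a
    non-root \<open>c\<close>.\<close>
  define \<Delta> where "\<Delta> = (\<Sum>e\<le>W. C e * (- b) ^ e)"
  have "\<Delta> \<noteq> 0" using nz by (simp add: \<Delta>_def poly_sum poly_monom)
  moreover have "degree \<Delta> \<le> D"
    unfolding \<Delta>_def
  proof (rule degree_sum_le)
    fix e assume e: "e \<in> {..W}"
    have "degree (C e * (- b) ^ e) \<le> degree (C e) + degree ((- b) ^ e)"
      by (rule degree_mult_le)
    also have "degree ((- b) ^ e) \<le> degree (- b) * e" by (rule degree_power_le)
    also have "\<dots> \<le> d * W" using b e by (intro mult_mono) (auto simp: polys_def)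
    also have "degree (C e) \<le> E" using C e by (auto simp: polys_def)
    finally show "degree (C e * (- b) ^ e) \<le> D" by (simp add: D)
  qed simp
  ultimately obtain c where c: "c \<in> F" "poly \<Delta> c \<noteq> 0"
    using exists_nonroot[of \<Delta>] D(2) by auto
  define mu' where "mu' = mu - sc c * lam"
  have lm: "lam \<in> G 1" "mu \<in> G 1" using rs by auto
  have mu': "mu' \<in> G 1" unfolding mu'_def by (intro G_diff G_sc_mult lm c)
  define J where "J = adjoin_list I rest"
  have "mset ((lam, 1) # (mu, 1) # rest) = mset (rest @ [(lam, 1), (mu, 1)])" by simp
  from regseq_perm[OF this I rs] have rJ: "regseq I rest" "regular J lam 1" "regular (adjoin J lam 1) mu 1"
    by (auto simp: regseq_append J_def)
  have J: "gideal J" unfolding J_def by (rule gideal_adjoin_list[OF I rJ(1)])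
  have Jl: "gideal (adjoin J lam 1)" by (rule gideal_adjoin[OF J lm(1)])
  \<comment> \<open>\<open>mu\<close> and \<open>mu'\<close> agree modulo \<open>lam\<close>, so
    \<open>mu'\<close> may replace \<open>mu\<close>; swapping then puts \<open>lam\<close>
    last.\<close>
  have "sc c * lam \<in> adjoin J lam 1 (0 + 1)"
    by (intro gideal_mult[OF Jl] sc_G c adjoin_generator J)
  then have mm: "mu - mu' \<in> adjoin J lam 1 1" by (simp add: mu'_def)
  have "regular (adjoin J lam 1) mu' 1" using regular_cong[OF Jl mm] rJ(3) by simp
  from regular_swap[OF J lm(1) _ mu' _ rJ(2) this]
  have rJ': "regular J mu' 1" "regular (adjoin J mu' 1) lam 1" by auto
  define J' where "J' = adjoin J mu' 1"
  have J': "gideal J'" unfolding J'_def by (rule gideal_adjoin[OF J mu'])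
  have gG: "g \<in> G (int d)"
    unfolding g using b by (intro G_add g0 bform_G lm) (auto simp: polys_def)
  define J'' where "J'' = adjoin J' g d"
  have J'': "gideal J''" unfolding J''_def by (rule gideal_adjoin[OF J' gG])
  have sub: "u \<in> J D \<Longrightarrow> u \<in> J'' D" "u \<in> J' D \<Longrightarrow> u \<in> J'' D" for u D
    unfolding J'_def J''_def by (simp_all add: adjoin_superset)
  have mu'J: "mu - sc c * lam \<in> J'' 1"
    using sub(2) adjoin_generator[OF J, of mu' 1] unfolding J'_def mu'_def by auto
  define \<beta> where "\<beta> = sc (poly b c) * lam ^ d"
  have \<beta>G: "\<beta> \<in> G (int d)"
    unfolding \<beta>_def using G_power[OF lm(1), of d] by (intro G_sc_mult polys_poly[OF b] c) simp
  have "g \<in> J'' (int d)"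
    unfolding J''_def using adjoin_generator[OF J'] by simp
  then have "g - (bform lam mu d b - \<beta>) \<in> J'' (int d)"
    unfolding \<beta>_def by (intro gideal_diff[OF J''] bform_cong[OF J'' lm mu'J c(1) b]) simp_all
  then have g0\<beta>: "g0 - (- \<beta>) \<in> J'' (int d)" by (simp add: g algebra_simps)
  have "(\<Sum>e\<le>W. bform lam mu (D - d * e) (C e) * g0 ^ e) - sc (poly \<Delta> c) * lam ^ D \<in> J'' (int D)"
  proof -
    have "sc (poly (C e * (- b) ^ e) c) * lam ^ D =
        sc (poly (C e) c) * lam ^ (D - d * e) * (- \<beta>) ^ e" if "e \<le> W" for e
    proof -
      have "d * e \<le> D" using that D by (metis le_add2 le_trans mult_le_mono2)
      then have "lam ^ D = lam ^ (D - d * e) * (lam ^ d) ^ e"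
        by (simp flip: power_mult power_add)
      moreover have "- \<beta> = sc (- poly b c) * lam ^ d" by (simp add: \<beta>_def sc_uminus)
      ultimately show ?thesis
        by (simp add: poly_power sc_mult sc_power power_mult_distrib algebra_simps)
    qed
    \<comment> \<open>Two substitutions, one at a time: \<open>g0\<close> by
      \<open>- \<beta>\<close>, then \<open>mu\<close> by \<open>c * lam\<close> inside the
      coefficients.\<close>
    then have "(\<Sum>e\<le>W. bform lam mu (D - d * e) (C e) * g0 ^ e) - sc (poly \<Delta> c) * lam ^ D =
      (\<Sum>e\<le>W. bform lam mu (D - d * e) (C e) * (g0 ^ e - (- \<beta>) ^ e) +
         (- \<beta>) ^ e * (bform lam mu (D - d * e) (C e) - sc (poly (C e) c) * lam ^ (D - d * e)))"
      unfolding \<Delta>_def poly_sum sc_sum sum_distrib_right sum_subtractf[symmetric]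
      by (intro sum.cong) (auto simp: algebra_simps)
    also have "\<dots> \<in> J'' (int D)"
    proof (intro gideal_sum[OF J''])
      fix e assume e: "e \<in> {..W}"
      then have de: "d * e \<le> d * W" by simp
      then have "d * e \<le> D" using D(1) by linarith
      then have eq: "int (D - d * e) + int e * int d = int D" "int e * int d + int (D - d * e) = int D"
        by (simp_all add: of_nat_diff algebra_simps)
      have E: "E \<le> D - d * e" using de D(1) by linarith
      have Ce: "C e \<in> polys E" using C e by simp
      then have cf: "\<And>i. coeff (C e) i \<in> F" by (auto simp: polys_def)
      have "bform lam mu (D - d * e) (C e) * (g0 ^ e - (- \<beta>) ^ e) \<in> J'' (int (D - d * e) + int e * int d)"
        by (intro cong_power_mult[OF J'' g0\<beta>] g0 G_uminus \<beta>G bform_G lm cf)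
      moreover have "(- \<beta>) ^ e * (bform lam mu (D - d * e) (C e) - sc (poly (C e) c) * lam ^ (D - d * e))
          \<in> J'' (int e * int d + int (D - d * e))"
        by (intro gideal_mult[OF J''] G_power G_uminus \<beta>G bform_cong[OF J'' lm mu'J c(1) Ce E])
      ultimately show "bform lam mu (D - d * e) (C e) * (g0 ^ e - (- \<beta>) ^ e) +
         (- \<beta>) ^ e * (bform lam mu (D - d * e) (C e) - sc (poly (C e) c) * lam ^ (D - d * e)) \<in> J'' (int D)"
        unfolding eq by (rule gideal_add[OF J''])
    qed
    finally show ?thesis .
  qed
  moreover have "(\<Sum>e\<le>W. bform lam mu (D - d * e) (C e) * g0 ^ e) \<in> J'' (int D)"
    using rel sub(1) by (simp add: J_def)
  ultimately have *: "sc (poly \<Delta> c) * lam ^ D \<in> J'' (int D)"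
    using gideal_diff[OF J''] by (metis diff_diff_eq2 add_diff_cancel_left')
  have degD: "poly \<Delta> c \<in> F"
    unfolding \<Delta>_def poly_sum poly_mult poly_power poly_minus
    using C b c(1) by (intro F_sum F_mult F_power F_uminus polys_poly) auto
  have "sc (inverse (poly \<Delta> c)) * (sc (poly \<Delta> c) * lam ^ D) \<in> J'' (0 + int D)"
    by (intro gideal_mult[OF J'' _ *] sc_G F_inverse degD)
  moreover have "sc (inverse (poly \<Delta> c)) * (sc (poly \<Delta> c) * lam ^ D) = lam ^ D"
    using c(2) by (simp add: sc_1 mult.assoc[symmetric] flip: sc_mult)
  ultimately have lamD: "lam ^ D \<in> J'' (int D)" by simp
  have lam_pow: "v \<in> J' m" if "v \<in> G m" "lam ^ n * v \<in> J' (m + int n)" for v m n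
    using that(2)
  proof (induction n)
    case (Suc n)
    have "lam ^ n * v \<in> J' (m + int n)"
    proof (rule regularD[OF rJ'(2)[folded J'_def]])
      show "lam ^ n * v \<in> G (m + int n)"
        using G_mult[OF G_power[OF lm(1), of n] that(1)] by (simp add: add.commute)
      show "lam * (lam ^ n * v) \<in> J' (m + int n + 1)"
        using Suc.prems by (simp add: algebra_simps)
    qed
    then show ?case by (rule Suc.IH)
  qed simp
  have rg: "regular J' g d"
    unfolding regular_def
  proof (intro allI ballI impI)
    fix m v assume v: "v \<in> G m" "g * v \<in> J' (m + int d)"
    obtain x y where xy: "x \<in> J' D" "y \<in> G (int D - d)" "lam ^ D = x + g * y"
      using lamD unfolding J''_def by (elim adjoinE)
    \<comment> \<open>If \<open>g\<close> kills \<open>v\<close> modulo \<open>J'\<close>, so does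
      \<open>lam ^ D = x + g * y\<close>, and powers of \<open>lam\<close> are regular modulo
      \<open>J'\<close>.\<close>
    have "lam ^ D * v = v * x + y * (g * v)" by (simp add: xy(3) algebra_simps)
    also have "v * x \<in> J' (m + int D)" by (rule gideal_mult[OF J' v(1) xy(1)])
    then have "v * x + y * (g * v) \<in> J' (m + int D)"
      using gideal_mult[OF J' xy(2) v(2)] by (intro gideal_add[OF J']) (simp_all add: algebra_simps)
    finally show "v \<in> J' m" by (intro lam_pow[OF v(1)])
  qed
  have "regseq I (rest @ [(mu', 1), (g, int d)])"
    using rJ(1) rJ' rg mu' gG d by (simp add: regseq_append J_def J'_def)
  moreover have ms: "mset (rest @ [(mu', 1), (g, int d)]) = mset ((g, int d) # (mu', 1) # rest)" by simp
  ultimately have reg: "regseq I ((g, int d) # (mu', 1) # rest)"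
    using regseq_perm[OF _ I] by blast
  have "mset ((lam, 1) # (mu, 1) # rest) = mset (rest @ [(lam, 1), (mu, 1)])" by simp
  \<comment> \<open>Adjoining \<open>lam\<close> to \<open>J'\<close> restores the original ideal,
    so \<open>W\<close> bounds the Hilbert function of \<open>J'\<close>; adjoining \<open>g\<close>
    then costs a factor \<open>d\<close>.\<close>
  from adjoin_list_perm[OF this, of I] have "adjoin_list I ((lam, 1) # (mu, 1) # rest) = adjoin (adjoin J lam 1) mu 1"
    by (simp add: adjoin_list_append J_def)
  also have "\<dots> = adjoin (adjoin J lam 1) mu' 1" by (rule adjoin_cong[OF Jl mm])
  also have "\<dots> = adjoin J' lam 1" unfolding J'_def by (rule adjoin_commute)
  finally have "hilb J' m \<le> real W" for m
    using W rJ'(2) by (intro hilb_le_of_adjoin[OF J' lm(1)]) (simp_all add: J'_def)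
  then have "(\<Sum>i\<in>{0..int M}. hilb (adjoin J' g (int d)) i) \<le> real (d * W)" for M
    unfolding sum_hilb_adjoin[OF J' gG rg] using sum_bounded_above[of "{..<d}" "\<lambda>t. hilb J' (int M - int t)" "real W"]
    by simp
  moreover have "adjoin_list I ((g, int d) # (mu', 1) # rest) = adjoin J' g (int d)"
    using adjoin_list_perm[OF ms, of I] by (simp add: adjoin_list_append J_def J'_def)
  ultimately show ?thesis using c(1) reg unfolding mu'_def by auto
qed

text \<open>The translates of a form by the binary forms in \<open>lam\<close> and \<open>mu\<close> are counted: on each such family at
  most \<open>W\<close> members are bad.\<close>

lemma card_bad_extensions:
  assumes I: "gideal I" and rs: "regseq I ((lam, 1) # (mu, 1) # rest)"
    and W: "\<And>M. (\<Sum>i\<in>{0..int M}. hilb (adjoin_list I ((lam, 1) # (mu, 1) # rest)) i) \<le> real W"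
    and d: "0 < d" and q: "d * W * W + d * W < card F"
  defines "good \<equiv> \<lambda>g. \<exists>c\<in>F. regseq I ((g, int d) # (mu - sc c * lam, 1) # rest) \<and>
    (\<forall>M. (\<Sum>i\<in>{0..int M}. hilb (adjoin_list I ((g, int d) # (mu - sc c * lam, 1) # rest)) i) \<le> real (d * W))"
  shows "card {g \<in> G (int d). \<not> good g} * card F ^ (d + 1) \<le> W * card (G (int d))"
proof -
  \<comment> \<open>With this \<open>E\<close>, the product \<open>(D + 1) * W\<close> equals
    \<open>E * W + E + W\<close>, one less than the number \<open>(E + 1) * (W + 1)\<close> of free
    coefficients.\<close>
  define E where "E = d * W * W"
  define D where "D = E + d * W"
  have lm: "lam \<in> G 1" "mu \<in> G 1" using rs by auto
  define J where "J = adjoin_list I rest"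
  have "mset ((lam, 1) # (mu, 1) # rest) = mset (rest @ [(lam, 1), (mu, 1)])" by simp
  note perm = regseq_perm[OF this I rs] adjoin_list_perm[OF this, of I]
  have rJ: "regseq I rest" "regular J lam 1" "regular (adjoin J lam 1) mu 1"
    using perm(1) by (auto simp: regseq_append J_def)
  have J: "gideal J" unfolding J_def by (rule gideal_adjoin_list[OF I rJ(1)])
  have Jl: "gideal (adjoin J lam 1)" by (rule gideal_adjoin[OF J lm(1)])
  \<comment> \<open>Dropping \<open>mu\<close> leaves a Hilbert function bounded by
    \<open>W\<close>; dropping \<open>lam\<close> as well leaves one of linear growth.\<close>
  have "hilb (adjoin J lam 1) m \<le> W" for m
    using W perm(2) by (intro hilb_le_of_adjoin[OF Jl lm(2) rJ(3)]) (simp add: adjoin_list_append J_def)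
  then have "hilb J (int D) \<le> real (D + 1) * W"
    unfolding hilb_eq_sum_adjoin[OF J lm(1) rJ(2)]
    using sum_bounded_above[of "{0..int D}" "hilb (adjoin J lam 1)" "real W"] by (simp add: add.commute)
  also have "(D + 1) * W < (E + 1) * (W + 1)"
    by (simp add: D_def E_def algebra_simps)
  then have "real (D + 1) * W < real ((E + 1) * (W + 1))"
    by (simp only: of_nat_less_iff flip: of_nat_mult)
  finally have h: "hilb J (int D) < real ((E + 1) * (W + 1))" .
  define R where "R g0 = {b \<in> polys d. \<not> good (g0 + bform lam mu d b)}" for g0
  have R: "card (R g0) \<le> W" if g0: "g0 \<in> G (int d)" for g0
  proof -
    obtain C where C: "\<forall>e\<le>W. C e \<in> polys E" "\<exists>e\<le>W. C e \<noteq> 0"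
      "(\<Sum>e\<le>W. bform lam mu (D - d * e) (C e) * g0 ^ e) \<in> J (int D)"
      using exists_relation[OF J lm g0 _ h] by (auto simp: D_def)
    define \<Phi> where "\<Phi> = (\<Sum>e\<le>W. monom (C e) e)"
    have cf: "coeff \<Phi> e = C e" if "e \<le> W" for e
      using that by (simp add: \<Phi>_def coeff_sum)
    have "\<Phi> \<noteq> 0" using C(2) cf by fastforce
    have "degree \<Phi> \<le> W"
      unfolding \<Phi>_def by (intro degree_sum_le) (auto intro: order_trans[OF degree_monom_le])
    have "poly \<Phi> (- b) = 0" if b: "b \<in> R g0" for b
    proof (rule ccontr)
      assume "poly \<Phi> (- b) \<noteq> 0"
      then have "good (g0 + bform lam mu d b)"
        unfolding good_def using b C q
        by (intro extend_regseq[OF I rs W g0 d D_def _ _ _ _ _ refl, of C])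
           (auto simp: R_def \<Phi>_def D_def E_def J_def)
      then show False using b by (simp add: R_def)
    qed
    then have "uminus ` R g0 \<subseteq> {x. poly \<Phi> x = 0}" by auto
    then have "card (uminus ` R g0) \<le> card {x. poly \<Phi> x = 0}"
      using \<open>\<Phi> \<noteq> 0\<close> by (intro card_mono poly_roots_finite)
    also have "\<dots> \<le> degree \<Phi>" by (rule card_poly_roots_bound) fact
    finally show ?thesis using \<open>degree \<Phi> \<le> W\<close> by (simp add: card_image)
  qed
  let ?B = "{g \<in> G (int d). \<not> good g}"
  have fR: "finite (R g0)" for g0 unfolding R_def using card_polys[of d] by simp
  have bf: "bform lam mu d b \<in> G (int d)" if "b \<in> polys d" for b
    using that by (intro bform_G lm) (auto simp: polys_def)
  \<comment> \<open>Double counting: a bad \<open>g\<close> with any \<open>b\<close> is sent to the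
    base form obtained by subtracting the binary form of \<open>b\<close>, for which
    \<open>b\<close> is a bad translate.\<close>
  have "card (?B \<times> polys d) \<le> card (SIGMA g0:G (int d). R g0)"
  proof (rule card_inj_on_le)
    show "inj_on (\<lambda>(g, b). (g - bform lam mu d b, b)) (?B \<times> polys d)"
      by (auto simp: inj_on_def)
    show "(\<lambda>(g, b). (g - bform lam mu d b, b)) ` (?B \<times> polys d) \<subseteq> (SIGMA g0:G (int d). R g0)"
      using bf by (auto simp: R_def intro: G_diff)
    show "finite (SIGMA g0:G (int d). R g0)" using finite_G fR by blast
  qed
  also have "\<dots> = (\<Sum>g0\<in>G (int d). card (R g0))"
    using finite_G fR by (intro card_SigmaI) auto
  also have "\<dots> \<le> W * card (G (int d))"
    using sum_bounded_above[of "G (int d)" "\<lambda>g. card (R g)" W] R by (simp add: mult.commute)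
  finally show ?thesis using card_polys[of d] by (simp add: card_cartesian_product)
qed

end

section \<open>Forms over a finite subfield of an infinite field\<close>

lemma sum_powers_le: "(\<Sum>i\<le>k. a ^ i) \<le> (a + 1) ^ k" for a :: nat
proof (induction k)
  case (Suc k)
  have "a ^ Suc k \<le> a * (a + 1) ^ k" by (simp add: power_mono)
  moreover have "(a + 1) ^ Suc k = (a + 1) ^ k + a * (a + 1) ^ k" by simp
  ultimately show ?case using Suc unfolding sum.atMost_Suc by linarith
qed simp

locale finite_subfield =
  fixes F :: "'a::field set" and k :: nat
  assumes finite_F: "finite F"
    and F_0: "0 \<in> F" and F_1: "1 \<in> F"
    and F_add: "\<And>a b. a \<in> F \<Longrightarrow> b \<in> F \<Longrightarrow> a + b \<in> F"
    and F_uminus: "\<And>a. a \<in> F \<Longrightarrow> - a \<in> F"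
    and F_mult: "\<And>a b. a \<in> F \<Longrightarrow> b \<in> F \<Longrightarrow> a * b \<in> F"
    and F_inverse: "\<And>a. a \<in> F \<Longrightarrow> inverse a \<in> F"
    and infinite_UNIV: "infinite (UNIV :: 'a set)"
begin

text \<open>Forms are represented by their functions on the infinite field, so that no identity between
  polynomials is lost; their coefficients lie in \<open>F\<close>.\<close>

primrec forms :: "nat \<Rightarrow> ((nat \<Rightarrow> 'a) \<Rightarrow> 'a) set" where
  "forms 0 = (\<lambda>c _. c) ` F"
| "forms (Suc D) = {(\<lambda>x. \<Sum>i\<le>k. x i * f i x) | f. \<forall>i\<le>k. f i \<in> forms D}"

lemma const_forms: "c \<in> F \<Longrightarrow> (\<lambda>_. c) \<in> forms 0"
  by simp

lemma zero_forms: "(\<lambda>_. 0) \<in> forms D"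
proof (induction D)
  case (Suc D)
  then show ?case by (auto intro!: exI[of _ "\<lambda>_ _. 0"])
qed (use F_0 in auto)

lemma add_forms: "f \<in> forms D \<Longrightarrow> g \<in> forms D \<Longrightarrow> (\<lambda>x. f x + g x) \<in> forms D"
proof (induction D arbitrary: f g)
  case 0
  then show ?case using F_add by auto
next
  case (Suc D)
  then obtain f' g' where "\<forall>i\<le>k. f' i \<in> forms D" "\<forall>i\<le>k. g' i \<in> forms D"
    "f = (\<lambda>x. \<Sum>i\<le>k. x i * f' i x)" "g = (\<lambda>x. \<Sum>i\<le>k. x i * g' i x)"
    by auto
  with Suc.IH show ?case
    by (auto intro!: exI[of _ "\<lambda>i x. f' i x + g' i x"] simp: algebra_simps sum.distrib)
qed

lemma var_mult_forms:
  assumes "f \<in> forms D" "i \<le> k"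
  shows "(\<lambda>x. x i * f x) \<in> forms (Suc D)"
proof -
  define f' where "f' j = (if j = i then f else (\<lambda>_. 0))" for j
  have "(\<Sum>j\<le>k. x j * f' j x) = (\<Sum>j\<le>k. if i = j then x j * f x else 0)" for x
    by (intro sum.cong) (auto simp: f'_def)
  then have "(\<lambda>x. x i * f x) = (\<lambda>x. \<Sum>j\<le>k. x j * f' j x)"
    using assms(2) by (simp add: fun_eq_iff)
  moreover have "\<forall>j\<le>k. f' j \<in> forms D" using assms(1) zero_forms by (auto simp: f'_def)
  ultimately show ?thesis by auto
qed

text \<open>Forms are defined by sums over all variables; an inner induction on the number of
  summands reduces these to single products and binary sums.\<close>

lemma forms_induct [consumes 1, case_names const var add]:
  assumes "f \<in> forms D"
    and const: "\<And>c. c \<in> F \<Longrightarrow> P 0 (\<lambda>_. c)"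
    and var: "\<And>D f i. f \<in> forms D \<Longrightarrow> P D f \<Longrightarrow> i \<le> k \<Longrightarrow> P (Suc D) (\<lambda>x. x i * f x)"
    and add: "\<And>D f g. f \<in> forms D \<Longrightarrow> g \<in> forms D \<Longrightarrow> P D f \<Longrightarrow> P D g \<Longrightarrow> P D (\<lambda>x. f x + g x)"
  shows "P D f"
  using assms(1)
proof (induction D arbitrary: f)
  case 0
  then show ?case using const by auto
next
  case (Suc D)
  then obtain f' where f': "\<forall>i\<le>k. f' i \<in> forms D" "f = (\<lambda>x. \<Sum>i\<le>k. x i * f' i x)"
    by auto
  have "(\<lambda>x. \<Sum>i\<le>n. x i * f' i x) \<in> forms (Suc D) \<and> P (Suc D) (\<lambda>x. \<Sum>i\<le>n. x i * f' i x)"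
    if "n \<le> k" for n
    using that
  proof (induction n)
    case 0
    then show ?case using var[of "f' 0" D 0] var_mult_forms[of "f' 0" D 0] f' Suc.IH by auto
  next
    case (Suc n)
    have "(\<lambda>x. x (Suc n) * f' (Suc n) x) \<in> forms (Suc D)" "P (Suc D) (\<lambda>x. x (Suc n) * f' (Suc n) x)"
      using var[of "f' (Suc n)" D "Suc n"] var_mult_forms[of "f' (Suc n)" D "Suc n"]
        f' Suc.prems \<open>\<And>f. f \<in> forms D \<Longrightarrow> P D f\<close> by auto
    moreover have "(\<lambda>x. \<Sum>i\<le>n. x i * f' i x) \<in> forms (Suc D)" "P (Suc D) (\<lambda>x. \<Sum>i\<le>n. x i * f' i x)"
      using Suc.IH Suc.prems by auto
    ultimately show ?case unfolding sum.atMost_Suc using add add_forms by blast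
  qed
  then show ?case using f' by blast
qed

lemma scale_forms: "f \<in> forms D \<Longrightarrow> c \<in> F \<Longrightarrow> (\<lambda>x. c * f x) \<in> forms D"
proof (induction rule: forms_induct)
  case (const a)
  then show ?case using F_mult by auto
next
  case (var D f i)
  then have "(\<lambda>x. x i * (c * f x)) \<in> forms (Suc D)" by (intro var_mult_forms) auto
  then show ?case by (simp add: mult.left_commute)
next
  case (add D f g)
  then have "(\<lambda>x. c * f x + c * g x) \<in> forms D" by (intro add_forms) auto
  then show ?case by (simp add: distrib_left)
qed

lemma mult_forms: "f \<in> forms D \<Longrightarrow> g \<in> forms e \<Longrightarrow> (\<lambda>x. f x * g x) \<in> forms (D + e)"
proof (induction rule: forms_induct)
  case (const a)
  then show ?case using scale_forms by simp
next
  case (var D f i)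
  then have "(\<lambda>x. x i * (f x * g x)) \<in> forms (Suc (D + e))" by (intro var_mult_forms) auto
  then show ?case by (simp only: mult.assoc add_Suc)
next
  case (add D f f')
  then have "(\<lambda>x. f x * g x + f' x * g x) \<in> forms (D + e)" by (intro add_forms) auto
  then show ?case by (simp add: distrib_right)
qed

lemma finite_forms: "finite (forms D)"
proof (induction D)
  case (Suc D)
  have "forms (Suc D) \<subseteq> (\<lambda>f x. \<Sum>i\<le>k. x i * f i x) ` (PiE {..k} (\<lambda>_. forms D))"
  proof
    fix g assume "g \<in> forms (Suc D)"
    then obtain f where f: "\<forall>i\<le>k. f i \<in> forms D" "g = (\<lambda>x. \<Sum>i\<le>k. x i * f i x)" by auto
    then show "g \<in> (\<lambda>f x. \<Sum>i\<le>k. x i * f i x) ` (PiE {..k} (\<lambda>_. forms D))"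
      by (intro image_eqI[of _ _ "restrict f {..k}"]) auto
  qed
  then show ?case by (rule finite_subset) (intro finite_imageI finite_PiE; simp add: Suc)
qed (use finite_F in auto)

section \<open>The graded algebra of forms\<close>

definition G :: "int \<Rightarrow> ((nat \<Rightarrow> 'a) \<Rightarrow> 'a) set" where
  "G D = (if D < 0 then {0} else forms (nat D))"

lemma G_int: "G (int D) = forms D"
  by (simp add: G_def)

sublocale graded_algebra G F "\<lambda>c _. c"
proof
  fix D e u v
  show "u * v \<in> G (D + e)" if "u \<in> G D" "v \<in> G e"
  proof (cases "D < 0 \<or> e < 0")
    case True
    then have "u * v = 0" using that by (auto simp: G_def)
    then show ?thesis using zero_forms by (auto simp: G_def zero_fun_def)
  next
    case False
    then show ?thesis
      using that mult_forms[of u "nat D" v "nat e"] by (simp add: G_def times_fun_def nat_add_distrib)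
  qed
  show "u + v \<in> G D" if "u \<in> G D" "v \<in> G D"
    using that add_forms by (auto simp: G_def plus_fun_def)
  show "- u \<in> G D" if "u \<in> G D"
    using that scale_forms[of u _ "- 1"] F_uminus[OF F_1] by (auto simp: G_def fun_Compl_def split: if_splits)
qed (auto simp: G_def finite_F F_0 F_1 F_add F_uminus F_mult F_inverse finite_forms
      zero_forms zero_fun_def plus_fun_def times_fun_def one_fun_def)

section \<open>The coordinate functions as a regular sequence\<close>

definition zero_ideal :: "int \<Rightarrow> ((nat \<Rightarrow> 'a) \<Rightarrow> 'a) set" where
  "zero_ideal D = {0}"

lemma gideal_zero_ideal: "gideal zero_ideal"
  using gideal_zero by (simp add: gideal_def zero_ideal_def)

definition vars :: "nat \<Rightarrow> (((nat \<Rightarrow> 'a) \<Rightarrow> 'a) \<times> int) list" where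
  "vars n = map (\<lambda>i. (\<lambda>x. x i, 1)) [0..<n]"

lemma vars_Suc: "vars (Suc n) = vars n @ [(\<lambda>x. x n, 1)]"
  by (simp add: vars_def)

lemma var_G: "i \<le> k \<Longrightarrow> (\<lambda>x. x i) \<in> G 1"
  using var_mult_forms[OF const_forms[OF F_1], of i] by (simp add: G_def del: forms.simps)

lemma forms_line: "f \<in> forms D \<Longrightarrow> \<exists>p. \<forall>t. f (x(n := t)) = poly p t"
proof (induction rule: forms_induct)
  case (const c)
  then show ?case by (intro exI[of _ "[:c:]"]) simp
next
  case (var D f i)
  then obtain p where p: "\<forall>t. f (x(n := t)) = poly p t" by blast
  show ?case
    unfolding p[rule_format]
    by (intro exI[of _ "(if i = n then [:0, 1:] else [:x i:]) * p"]) simp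
next
  case (add D f g)
  then obtain p p' where "\<forall>t. f (x(n := t)) = poly p t" "\<forall>t. g (x(n := t)) = poly p' t" by blast
  then show ?case by (intro exI[of _ "p + p'"] allI) (simp only: poly_add)
qed

text \<open>On a coordinate line a form is a polynomial in \<open>t\<close>, and infinitely many
  zeros force it to vanish. The infinite ambient field enters here.\<close>

lemma forms_eq_0_continue:
  assumes "f \<in> forms D" "\<And>t. t \<noteq> 0 \<Longrightarrow> f (x(n := t)) = 0"
  shows "f (x(n := 0)) = 0"
proof -
  obtain p where p: "\<And>t. f (x(n := t)) = poly p t" using forms_line[OF assms(1), of x n] by blast
  have "UNIV - {0} \<subseteq> {t. poly p t = 0}" using assms(2) p by auto
  then have "infinite {t. poly p t = 0}"
    using infinite_UNIV by (meson finite.emptyI finite_Diff2 finite_insert finite_subset)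
  then have "p = 0" using poly_roots_finite by blast
  then show ?thesis using p by simp
qed

text \<open>Division by \<open>x n\<close>; the remainder is the form restricted to the hyperplane
  \<open>x n = 0\<close>.\<close>

lemma forms_split:
  assumes "f \<in> forms D" "n \<le> k"
  shows "(\<lambda>x. f (x(n := 0))) \<in> forms D \<and> (\<exists>v\<in>G (int D - 1). \<forall>x. f x = f (x(n := 0)) + x n * v x)"
  using assms(1)
proof (induction rule: forms_induct)
  case (const c)
  then show ?case by (auto intro: bexI[of _ 0] simp: G_0)
next
  case (var D f i)
  then obtain v where v: "v \<in> G (int D - 1)" "\<And>x. f x = f (x(n := 0)) + x n * v x" by blast
  show ?case
  proof (cases "i = n")
    case True
    have "f \<in> G (int (Suc D) - 1)" using var(1) by (simp add: G_def)
    moreover have "(\<lambda>x. (x(n := 0)) i * f (x(n := 0))) \<in> forms (Suc D)"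
      using True zero_forms[of "Suc D"] by (simp del: forms.simps)
    moreover have "x i * f x = (x(n := 0)) i * f (x(n := 0)) + x n * f x" for x
      using True by simp
    ultimately show ?thesis by blast
  next
    case False
    have "(\<lambda>x. x i) * v \<in> G (1 + (int D - 1))" by (rule G_mult[OF var_G[OF var(2)] v(1)])
    then have "(\<lambda>x. x i) * v \<in> G (int (Suc D) - 1)" by simp
    moreover have "(\<lambda>x. x i * f (x(n := 0))) \<in> forms (Suc D)"
      using var(2,3) by (intro var_mult_forms) blast+
    then have "(\<lambda>x. (x(n := 0)) i * f (x(n := 0))) \<in> forms (Suc D)"
      using False by (simp del: forms.simps)
    moreover have "x i * f x = (x(n := 0)) i * f (x(n := 0)) + x n * ((\<lambda>x. x i) * v) x" for x
      using v(2)[of x] False by (simp add: algebra_simps)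
    ultimately show ?thesis by blast
  qed
next
  case (add D f g)
  then obtain v w where vw: "v \<in> G (int D - 1)" "\<And>x. f x = f (x(n := 0)) + x n * v x"
    "w \<in> G (int D - 1)" "\<And>x. g x = g (x(n := 0)) + x n * w x" by blast
  have "f x + g x = f (x(n := 0)) + g (x(n := 0)) + x n * (v + w) x" for x
    using vw(2)[of x] vw(4)[of x] by (simp add: algebra_simps)
  moreover have "v + w \<in> G (int D - 1)" by (intro G_add vw)
  moreover have "(\<lambda>x. f (x(n := 0)) + g (x(n := 0))) \<in> forms D"
    using add(3,4) by (intro add_forms) blast+
  ultimately show ?case by blast
qed

text \<open>Describes the ideal of the first \<open>n\<close> variables by vanishing. In the
  induction \<open>forms_split\<close> peels off one variable, and its remainder vanishes as soon as
  the earlier variables do.\<close>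

lemma adjoin_list_vars:
  assumes "n \<le> k + 1"
  shows "adjoin_list zero_ideal (vars n) D = {f \<in> G D. \<forall>x. (\<forall>i<n. x i = 0) \<longrightarrow> f x = 0}"
  using assms
proof (induction n arbitrary: D)
  case 0
  then show ?case using G_0[of D] by (auto simp: vars_def zero_ideal_def fun_eq_iff)
next
  case (Suc n)
  then have IH: "adjoin_list zero_ideal (vars n) D = {f \<in> G D. \<forall>x. (\<forall>i<n. x i = 0) \<longrightarrow> f x = 0}" for D
    by simp
  have n: "n \<le> k" using Suc by simp
  show ?case
  proof (intro equalityI subsetI)
    fix f assume "f \<in> adjoin_list zero_ideal (vars (Suc n)) D"
    then obtain u v where "u \<in> adjoin_list zero_ideal (vars n) D" "v \<in> G (D - 1)" "f = u + (\<lambda>x. x n) * v"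
      unfolding vars_Suc adjoin_list_append by (auto elim: adjoinE)
    then show "f \<in> {f \<in> G D. \<forall>x. (\<forall>i<Suc n. x i = 0) \<longrightarrow> f x = 0}"
      using G_mult[OF var_G[OF n], of v "D - 1"] by (auto simp: IH intro!: G_add)
  next
    fix f assume f: "f \<in> {f \<in> G D. \<forall>x. (\<forall>i<Suc n. x i = 0) \<longrightarrow> f x = 0}"
    have "\<exists>u\<in>adjoin_list zero_ideal (vars n) D. \<exists>v\<in>G (D - 1). f = u + (\<lambda>x. x n) * v"
    proof (cases "D < 0")
      case True
      then have "f = 0" using f by (simp add: G_def)
      then show ?thesis using True by (auto simp: IH G_def)
    next
      case False
      then obtain D' where D': "D = int D'" using nonneg_int_cases[of D] by auto
      obtain v where v: "(\<lambda>x. f (x(n := 0))) \<in> forms D'" "v \<in> G (D - 1)"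
        "\<And>x. f x = f (x(n := 0)) + x n * v x"
        using forms_split[of f D' n] f n unfolding D' G_int by blast
      have "(\<lambda>x. f (x(n := 0))) \<in> adjoin_list zero_ideal (vars n) D"
        using v(1) f by (auto simp: IH D' G_int less_Suc_eq)
      moreover have "f = (\<lambda>x. f (x(n := 0))) + (\<lambda>x. x n) * v"
        by (rule ext) (simp add: v(3)[symmetric])
      ultimately show ?thesis using v(2) by blast
    qed
    then show "f \<in> adjoin_list zero_ideal (vars (Suc n)) D"
      unfolding vars_Suc adjoin_list_append by (auto intro: adjoinI)
  qed
qed

lemma regseq_vars: "n \<le> k + 1 \<Longrightarrow> regseq zero_ideal (vars n)"
proof (induction n)
  case (Suc n)
  have "regular (adjoin_list zero_ideal (vars n)) (\<lambda>x. x n) 1"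
    unfolding regular_def
  proof (intro allI ballI impI)
    fix D v assume v: "v \<in> G D" "(\<lambda>x. x n) * v \<in> adjoin_list zero_ideal (vars n) (D + 1)"
    then have *: "x n * v x = 0" if "\<forall>i<n. x i = 0" for x
      using that Suc.prems by (auto simp: adjoin_list_vars fun_eq_iff)
    have "v x = 0" if x: "\<forall>i<n. x i = 0" for x
    proof (cases "D < 0 \<or> x n \<noteq> 0")
      case True
      then show ?thesis using *[OF x] v(1) by (auto simp: G_def)
    next
      case False
      \<comment> \<open>At a point with \<open>x n = 0\<close>, the form \<open>v\<close> vanishes
        by continuation along the line in direction \<open>n\<close>.\<close>
      then have "v (x(n := 0)) = 0"
        using v(1) *[of "x(n := _)"] x by (intro forms_eq_0_continue[of v "nat D"]) (auto simp: G_def)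
      then show ?thesis using False by (simp add: fun_upd_idem)
    qed
    then show "v \<in> adjoin_list zero_ideal (vars n) D"
      using v(1) Suc.prems by (simp add: adjoin_list_vars)
  qed
  then show ?case using Suc var_G[of n] by (simp add: vars_Suc regseq_append)
qed (simp add: vars_def)

text \<open>The quotient by all variables is concentrated in degree zero, where only scalars
  remain.\<close>

lemma sum_hilb_vars:
  "(\<Sum>i\<in>{0..int M}. hilb (adjoin_list zero_ideal (vars (k + 1))) i) \<le> 1"
proof -
  let ?I = "adjoin_list zero_ideal (vars (k + 1))"
  have I: "gideal ?I" by (rule gideal_adjoin_list[OF gideal_zero_ideal regseq_vars]) simp
  have h0: "hilb ?I 0 \<le> 1"
  proof -
    have "card (G 0) = card F" by (auto simp: G_def card_image inj_on_def fun_eq_iff)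
    moreover have "1 \<le> card (?I 0)" using gideal_card_pos[OF I, of 0] by simp
    ultimately have "real (card (G 0)) / real (card (?I 0)) \<le> card F"
      by (simp add: divide_le_eq mult_le_cancel_left1)
    moreover have "0 < real (card (G 0)) / real (card (?I 0))"
      using gideal_card_pos[OF I, of 0] card_G_pos[of 0] by simp
    ultimately show ?thesis
      unfolding hilb_def using card_F by (subst log_le_one_cancel_iff) auto
  qed
  have "hilb ?I i = 0" if i: "0 < i" for i
  proof -
    obtain D where "i = int (Suc D)"
      using zero_less_imp_eq_int[OF i] gr0_conv_Suc by auto
    then have "?I i = G i" by (auto simp: adjoin_list_vars G_def nat_add_distrib)
    then show ?thesis using card_G_pos[of i] by (simp add: hilb_def)
  qed
  then have "(\<Sum>i\<in>{0..int M}. hilb ?I i) = (\<Sum>i\<in>{0::int}. hilb ?I i)"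
    by (intro sum.mono_neutral_right) auto
  with h0 show ?thesis by simp
qed

section \<open>Points of the chart and interpolation\<close>

definition chart :: "(nat \<Rightarrow> 'a) set" where
  "chart = {z. z 0 = 1 \<and> (\<forall>i\<in>{1..k}. z i \<in> F) \<and> (\<forall>i>k. z i = 0)}"

lemma card_chart: "finite chart \<and> card chart = card F ^ k"
proof -
  define \<phi> where "\<phi> f i = (if i = 0 then 1 else if i \<le> k then f i else 0)" for f :: "nat \<Rightarrow> 'a" and i
  have inj: "inj_on \<phi> (PiE {1..k} (\<lambda>_. F))"
  proof (rule inj_onI)
    fix f g assume fg: "f \<in> PiE {1..k} (\<lambda>_. F)" "g \<in> PiE {1..k} (\<lambda>_. F)" "\<phi> f = \<phi> g"
    show "f = g"
    proof (rule PiE_ext[OF fg(1,2)])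
      fix i assume "i \<in> {1..k}"
      then show "f i = g i" using fun_cong[OF fg(3), of i] by (simp add: \<phi>_def)
    qed
  qed
  moreover have "\<phi> ` (PiE {1..k} (\<lambda>_. F)) = chart"
  proof (intro equalityI subsetI)
    fix z assume "z \<in> \<phi> ` (PiE {1..k} (\<lambda>_. F))"
    then show "z \<in> chart" by (auto simp: chart_def \<phi>_def PiE_def Pi_def)
  next
    fix z assume z: "z \<in> chart"
    have "z = \<phi> (restrict z {1..k})" using z by (auto simp: chart_def \<phi>_def fun_eq_iff)
    then show "z \<in> \<phi> ` (PiE {1..k} (\<lambda>_. F))"
      using z by (intro image_eqI[of _ _ "restrict z {1..k}"]) (auto simp: chart_def)
  qed
  moreover have "finite (PiE {1..k} (\<lambda>_. F))" by (intro finite_PiE) (auto simp: finite_F)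
  moreover have "card (PiE {1..k} (\<lambda>_. F)) = card F ^ k" by (simp add: card_PiE)
  ultimately show ?thesis by (metis card_image finite_imageI)
qed

lemma chart_F: "z \<in> chart \<Longrightarrow> z i \<in> F"
  by (cases "i = 0"; cases "i \<le> k") (auto simp: chart_def F_0 F_1)

lemma forms_F: "f \<in> forms D \<Longrightarrow> z \<in> chart \<Longrightarrow> f z \<in> F"
  by (induction rule: forms_induct) (auto intro: F_mult F_add chart_F)

text \<open>A product of linear forms, one for each point of \<open>W\<close>; powers of
  \<open>x 0\<close>, which equals one on the chart, raise the degree to \<open>D\<close>.\<close>

lemma exists_separating_form:
  assumes "finite W" "W \<subseteq> chart" "z \<in> chart" "z \<notin> W" "card W \<le> D"
  shows "\<exists>e\<in>forms D. e z = 1 \<and> (\<forall>w\<in>W. e w = 0)"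
proof -
  have "\<exists>e\<in>forms (card W). e z = 1 \<and> (\<forall>w\<in>W. e w = 0)"
    using assms(1,2,4)
  proof (induction W)
    case empty
    then show ?case using F_1 by auto
  next
    case (insert w W)
    then obtain e where e: "e \<in> forms (card W)" "e z = 1" "\<forall>w\<in>W. e w = 0" by auto
    have w: "w \<in> chart" "w \<noteq> z" using insert by auto
    have "\<exists>i. z i \<noteq> w i" using w(2) ext[of z w] by blast
    then obtain i where i: "z i \<noteq> w i" by blast
    have ik: "i \<le> k"
    proof (rule ccontr)
      assume "\<not> i \<le> k"
      then have "z i = 0" "w i = 0" using assms(3) w(1) by (auto simp: chart_def)
      with i show False by simp
    qed
    \<comment> \<open>The linear form \<open>a * (x i - w i * x 0)\<close> takes the value one at
      \<open>z\<close> and zero at \<open>w\<close>.\<close>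
    define a where "a = inverse (z i - w i)"
    have a: "a \<in> F" "a * w i \<in> F" "- (a * w i) \<in> F"
      unfolding a_def by (intro F_inverse F_diff F_mult F_uminus chart_F assms w)+
    have "(\<lambda>x. a * (x i * 1)) \<in> forms (Suc 0)" "(\<lambda>x. - (a * w i) * (x 0 * 1)) \<in> forms (Suc 0)"
      using a ik by (intro scale_forms var_mult_forms const_forms F_1; simp)+
    then have "(\<lambda>x. a * (x i * 1) + - (a * w i) * (x 0 * 1)) \<in> forms (Suc 0)"
      by (rule add_forms)
    from mult_forms[OF this e(1)]
    have "(\<lambda>x. (a * (x i * 1) + - (a * w i) * (x 0 * 1)) * e x) \<in> forms (card (insert w W))"
      using insert by simp
    moreover have "a * (z i * 1) + - (a * w i) * (z 0 * 1) = 1"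
    proof -
      have "z 0 = 1" using assms(3) by (simp add: chart_def)
      then have "a * (z i * 1) + - (a * w i) * (z 0 * 1) = a * (z i - w i)"
        by (simp add: algebra_simps)
      then show ?thesis using i by (simp add: a_def)
    qed
    moreover have "w 0 = 1" using w by (simp add: chart_def)
    ultimately show ?case using e
      by (intro bexI[of _ "\<lambda>x. (a * (x i * 1) + - (a * w i) * (x 0 * 1)) * e x"]) auto
  qed
  then obtain e where e: "e \<in> forms (card W)" "e z = 1" "\<forall>w\<in>W. e w = 0" by blast
  have pad: "(\<lambda>x. x 0 ^ n * e x) \<in> forms (card W + n)" for n
  proof (induction n)
    case (Suc n)
    have "(\<lambda>x. x 0 * (x 0 ^ n * e x)) \<in> forms (Suc (card W + n))"
      by (intro var_mult_forms Suc) simp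
    then show ?case by (simp add: mult.assoc del: forms.simps)
  qed (use e in simp)
  have "z 0 = 1" using assms(3) by (simp add: chart_def)
  then show ?thesis
    using pad[of "D - card W"] e assms(5)
    by (intro bexI[of _ "\<lambda>x. x 0 ^ (D - card W) * e x"]) auto
qed

text \<open>Separating forms of degree \<open>D\<close> interpolate arbitrary values in
  \<open>F\<close> on \<open>Z\<close>, and distinct value vectors give distinct classes modulo
  \<open>I\<close>.\<close>

lemma card_zeros_le_hilb:
  assumes I: "gideal I" and Z: "Z \<subseteq> chart" "card Z \<le> D"
    and zero: "\<And>u z. u \<in> I (int D) \<Longrightarrow> z \<in> Z \<Longrightarrow> u z = 0"
  shows "real (card Z) \<le> hilb I (int D)"
proof -
  have fZ: "finite Z" using Z card_chart finite_subset by blast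
  have "\<exists>e\<in>forms D. e z = 1 \<and> (\<forall>w\<in>Z - {z}. e w = 0)" if "z \<in> Z" for z
    using that Z fZ by (intro exists_separating_form) (auto intro: order_trans[OF card_mono])
  then obtain e where e: "\<And>z. z \<in> Z \<Longrightarrow> e z \<in> forms D"
    "\<And>z. z \<in> Z \<Longrightarrow> e z z = 1" "\<And>z w. z \<in> Z \<Longrightarrow> w \<in> Z \<Longrightarrow> w \<noteq> z \<Longrightarrow> e z w = 0"
    by (metis DiffI singletonD)
  define \<psi> where "\<psi> y = (\<Sum>z\<in>Z. (\<lambda>_. y z) * e z)" for y
  have \<psi>_val: "\<psi> y w = y w" if "w \<in> Z" for y w
  proof -
    have "\<psi> y w = (\<Sum>z\<in>Z. y z * e z w)"
      unfolding \<psi>_def by (induction Z rule: infinite_finite_induct) (auto simp: times_fun_def)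
    also have "\<dots> = (\<Sum>z\<in>Z. if w = z then y w else 0)"
      using e that by (intro sum.cong) auto
    finally show ?thesis using that fZ by simp
  qed
  have \<psi>_G: "\<psi> y \<in> G (int D)" if "y \<in> PiE Z (\<lambda>_. F)" for y
    unfolding \<psi>_def using that e(1) by (intro G_sum G_sc_mult) (auto simp: G_int)
  have "card (PiE Z (\<lambda>_. F) \<times> I (int D)) \<le> card (G (int D))"
  proof (rule card_inj_on_le[OF _ _ finite_G])
    show "inj_on (\<lambda>(y, u). \<psi> y + u) (PiE Z (\<lambda>_. F) \<times> I (int D))"
    proof (rule inj_onI)
      fix p p' assume p: "p \<in> PiE Z (\<lambda>_. F) \<times> I (int D)" "p' \<in> PiE Z (\<lambda>_. F) \<times> I (int D)"
        "(case p of (y, u) \<Rightarrow> \<psi> y + u) = (case p' of (y, u) \<Rightarrow> \<psi> y + u)"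
      obtain y u y' u' where [simp]: "p = (y, u)" "p' = (y', u')" by (cases p; cases p')
      have eq: "\<psi> y + u = \<psi> y' + u'" using p by simp
      have "y w = y' w" if w: "w \<in> Z" for w
        using fun_cong[OF eq, of w] p w zero[of u w] zero[of u' w] by (simp add: \<psi>_val)
      then have "y = y'" using p by (intro PiE_ext[of y Z _ y']) auto
      with eq show "p = p'" by simp
    qed
    show "(\<lambda>(y, u). \<psi> y + u) ` (PiE Z (\<lambda>_. F) \<times> I (int D)) \<subseteq> G (int D)"
      using \<psi>_G gideal_G[OF I] by (auto intro: G_add)
  qed
  then have "card F ^ card Z * card (I (int D)) \<le> card (G (int D))"
    by (simp add: card_cartesian_product card_PiE fZ)
  then have "real (card F) ^ card Z * real (card (I (int D))) \<le> real (card (G (int D)))"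
    by (metis of_nat_le_iff of_nat_mult of_nat_power)
  then have "real (card F) powr card Z \<le> real (card (G (int D))) / real (card (I (int D)))"
    using card_F gideal_card_pos[OF I, of "int D"] by (simp add: powr_realpow field_simps)
  then show ?thesis
    unfolding hilb_def using card_F card_G_pos[of "int D"] gideal_card_pos[OF I, of "int D"]
    by (subst le_log_iff) auto
qed

section \<open>Sequences of forms with few common zeros\<close>

text \<open>The bound on the sum says that the quotient by the whole sequence, of finite dimension, has dimension
  at most the product of the degrees.\<close>

definition good :: "nat \<Rightarrow> ((nat \<Rightarrow> 'a) \<Rightarrow> 'a) list \<Rightarrow> bool" where
  "good d gs \<longleftrightarrow> (\<exists>ls. length gs + length ls = k + 1 \<and> (\<forall>l\<in>set ls. snd l = 1) \<and>
     regseq zero_ideal (map (\<lambda>g. (g, int d)) gs @ ls) \<and>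
     (\<forall>M. (\<Sum>i\<in>{0..int M}. hilb (adjoin_list zero_ideal (map (\<lambda>g. (g, int d)) gs @ ls)) i)
        \<le> real (d ^ length gs)))"

lemma good_Nil: "good d []"
  unfolding good_def using regseq_vars[of "k + 1"] sum_hilb_vars
  by (intro exI[of _ "vars (k + 1)"]) (auto simp: vars_def)

lemma adjoin_list_vanish:
  assumes "u \<in> adjoin_list I xs D" "\<And>u D. u \<in> I D \<Longrightarrow> u z = 0" "\<And>g d. (g, d) \<in> set xs \<Longrightarrow> g z = 0"
  shows "u z = 0"
  using assms
proof (induction xs arbitrary: I)
  case (Cons x xs)
  obtain g d where x: "x = (g, d)" by (cases x)
  have "g z = 0" using Cons.prems(3)[of g d] by (simp add: x)
  then have "u z = 0" if "u \<in> adjoin I g d D" for u D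
    using that Cons.prems(2) by (auto elim!: adjoinE)
  moreover have "u \<in> adjoin_list (adjoin I g d) xs D" using Cons.prems(1) by (simp add: x)
  moreover have "g' z = 0" if "(g', d') \<in> set xs" for g' d'
    using that by (intro Cons.prems(3)[of g' d']) simp
  ultimately show ?case by (intro Cons.IH[of "adjoin I g d"])
qed auto

text \<open>A single linear form completes a good sequence of length \<open>k\<close>, so the
  Hilbert function modulo \<open>gs\<close> is at most \<open>d ^ k\<close>. Degree
  \<open>card ?Z\<close> is large enough for interpolation on the zeros.\<close>

lemma good_zeros:
  assumes "good d gs" "length gs = k"
  shows "card {z\<in>chart. \<forall>g\<in>set gs. g z = 0} \<le> d ^ k"
proof -
  let ?Z = "{z\<in>chart. \<forall>g\<in>set gs. g z = 0}"
  let ?gs = "map (\<lambda>g. (g, int d)) gs"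
  obtain ls where ls: "length gs + length ls = k + 1" "\<forall>l\<in>set ls. snd l = 1"
     "regseq zero_ideal (?gs @ ls)"
     "\<And>M. (\<Sum>i\<in>{0..int M}. hilb (adjoin_list zero_ideal (?gs @ ls)) i) \<le> real (d ^ length gs)"
    using assms(1) unfolding good_def by blast
  from ls(1) assms(2) have "length ls = 1" by simp
  then obtain l where "ls = [(l, 1)]" using ls(2) by (cases ls) auto
  let ?I = "adjoin_list zero_ideal ?gs"
  have I: "gideal ?I" "l \<in> G 1" "regular ?I l 1"
    using ls(3) gideal_adjoin_list[OF gideal_zero_ideal, of ?gs] by (auto simp: \<open>ls = [(l, 1)]\<close> regseq_append)
  have "u z = 0" if "u \<in> ?I D" "z \<in> ?Z" for u z D
    by (rule adjoin_list_vanish[OF that(1)]) (use that(2) in \<open>auto simp: zero_ideal_def\<close>)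
  then have "real (card ?Z) \<le> hilb ?I (int (card ?Z))"
    by (intro card_zeros_le_hilb[OF I(1)]) auto
  also have "\<dots> \<le> real (d ^ length gs)"
    using ls(4) by (intro hilb_le_of_adjoin[OF I]) (simp add: \<open>ls = [(l, 1)]\<close> adjoin_list_append)
  finally show ?thesis using assms(2) by (simp only: of_nat_le_iff)
qed

text \<open>As \<open>length gs < k\<close>, at least two linear forms complete \<open>gs\<close>,
  and \<open>card_bad_extensions\<close> applies with \<open>W = d ^ length gs\<close>. The bound is
  then enlarged to one depending only on \<open>d\<close> and \<open>k\<close>.\<close>

lemma good_extend:
  assumes gs: "good d gs" "length gs < k" and d: "0 < d"
    and q: "d * d ^ k * d ^ k + d * d ^ k < card F"
  shows "card {g \<in> forms d. \<not> good d (gs @ [g])} * card F ^ (d + 1) \<le> d ^ k * card (forms d)"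
proof -
  let ?gs = "map (\<lambda>g. (g, int d)) gs"
  let ?W = "d ^ length gs"
  obtain ls where ls: "length gs + length ls = k + 1" "\<forall>l\<in>set ls. snd l = 1"
     "regseq zero_ideal (?gs @ ls)"
     "\<And>M. (\<Sum>i\<in>{0..int M}. hilb (adjoin_list zero_ideal (?gs @ ls)) i) \<le> real ?W"
    using assms(1) unfolding good_def by blast
  have "2 \<le> length ls" using ls(1) gs(2) by simp
  then obtain lam mu rest where l: "ls = (lam, 1) # (mu, 1) # rest"
    using ls(2) by (cases ls; cases "tl ls") auto
  let ?I = "adjoin_list zero_ideal ?gs"
  have I: "gideal ?I" "regseq ?I ((lam, 1) # (mu, 1) # rest)" "regseq zero_ideal ?gs"
    using ls(3) gideal_adjoin_list[OF gideal_zero_ideal, of ?gs] by (auto simp: l regseq_append)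
  define P where "P = (\<lambda>g. \<exists>c\<in>F. regseq ?I ((g, int d) # (mu - (\<lambda>_. c) * lam, 1) # rest) \<and>
    (\<forall>M. (\<Sum>i\<in>{0..int M}. hilb (adjoin_list ?I ((g, int d) # (mu - (\<lambda>_. c) * lam, 1) # rest)) i) \<le> real (d * ?W)))"
  have Wk: "?W \<le> d ^ k" using d gs(2) by (intro power_increasing) auto
  have "d * ?W * ?W + d * ?W \<le> d * d ^ k * d ^ k + d * d ^ k"
    using Wk by (intro add_mono mult_mono) auto
  then have q': "d * ?W * ?W + d * ?W < card F" using q by linarith
  have "card {g \<in> G (int d). \<not> P g} * card F ^ (d + 1) \<le> ?W * card (G (int d))"
    unfolding P_def using ls(4)
    by (intro card_bad_extensions[OF I(1,2) _ d q']) (simp add: l adjoin_list_append)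
  moreover have "good d (gs @ [g])" if "P g" for g
  proof -
    obtain c where c: "c \<in> F" "regseq ?I ((g, int d) # (mu - (\<lambda>_. c) * lam, 1) # rest)"
      "\<And>M. (\<Sum>i\<in>{0..int M}. hilb (adjoin_list ?I ((g, int d) # (mu - (\<lambda>_. c) * lam, 1) # rest)) i) \<le> real (d * ?W)"
      using \<open>P g\<close> unfolding P_def by blast
    have "regseq zero_ideal (map (\<lambda>g. (g, int d)) (gs @ [g]) @ (mu - (\<lambda>_. c) * lam, 1) # rest)"
      using c(2) I(3) by (simp add: regseq_append)
    moreover have "adjoin_list zero_ideal (map (\<lambda>g. (g, int d)) (gs @ [g]) @ (mu - (\<lambda>_. c) * lam, 1) # rest) =
        adjoin_list ?I ((g, int d) # (mu - (\<lambda>_. c) * lam, 1) # rest)"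
      by (simp add: adjoin_list_append)
    ultimately show ?thesis
      unfolding good_def using c(3) ls(1,2)
      by (intro exI[of _ "(mu - (\<lambda>_. c) * lam, 1) # rest"] conjI) (simp_all add: l)
  qed
  then have "card {g \<in> forms d. \<not> good d (gs @ [g])} \<le> card {g \<in> G (int d). \<not> P g}"
    unfolding G_int using finite_forms by (intro card_mono) auto
  ultimately have "card {g \<in> forms d. \<not> good d (gs @ [g])} * card F ^ (d + 1) \<le> ?W * card (G (int d))"
    by (meson le_trans mult_le_mono1)
  also have "\<dots> \<le> d ^ k * card (G (int d))" using Wk by simp
  finally show ?thesis by (simp add: G_int)
qed

section \<open>Greedy choice of the forms\<close>

text \<open>The family grows at the front of the list, so the last entry of a sublist is its oldest member.\<close>

definition diffs :: "((nat \<Rightarrow> 'a) \<Rightarrow> 'a) list \<Rightarrow> ((nat \<Rightarrow> 'a) \<Rightarrow> 'a) list" where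
  "diffs ys = map (\<lambda>f. f - last ys) (rev (butlast ys))"

lemma diffs_Cons: "ys \<noteq> [] \<Longrightarrow> diffs (f # ys) = diffs ys @ [f - last ys]"
  by (simp add: diffs_def)

text \<open>A new form can fail only through a nonempty sublist of at most \<open>k\<close> earlier
  forms. There are at most \<open>Suc N ^ k\<close> of these, each excluding at most a fraction
  \<open>d^k / q^(d+1)\<close> of all forms, where \<open>q = card F\<close>; the hypothesis on
  \<open>N\<close> leaves a choice.\<close>

lemma exists_good_family:
  assumes d: "0 < d" and q: "d * d ^ k * d ^ k + d * d ^ k < card F"
    and N: "(N * d) ^ k < card F ^ (d + 1)"
  shows "\<exists>fs. length fs = N \<and> set fs \<subseteq> forms d \<and>
    (\<forall>ys. subseq ys fs \<longrightarrow> ys \<noteq> [] \<longrightarrow> length ys \<le> k + 1 \<longrightarrow> good d (diffs ys))"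
  using N
proof (induction N)
  case 0
  then show ?case by simp
next
  case (Suc N)
  have "(N * d) ^ k \<le> (Suc N * d) ^ k" by (intro power_mono mult_right_mono) auto
  then obtain fs where fs: "length fs = N" "set fs \<subseteq> forms d"
    "\<And>ys. subseq ys fs \<Longrightarrow> ys \<noteq> [] \<Longrightarrow> length ys \<le> k + 1 \<Longrightarrow> good d (diffs ys)"
    using Suc by fastforce
  define Y where "Y = {ys. subseq ys fs \<and> ys \<noteq> [] \<and> length ys \<le> k}"
  define A where "A ys = {f \<in> forms d. \<not> good d (diffs ys @ [f - last ys])}" for ys
  have Ysub: "Y \<subseteq> {ys. set ys \<subseteq> set fs \<and> length ys \<le> k}"
  proof
    fix ys assume ys: "ys \<in> Y"
    then obtain S where "ys = nths fs S" by (auto simp: Y_def subseq_conv_nths)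
    then show "ys \<in> {ys. set ys \<subseteq> set fs \<and> length ys \<le> k}"
      using ys set_nths_subset[of fs S] by (simp add: Y_def)
  qed
  have fY: "finite Y" using Ysub finite_lists_length_le[of "set fs" k] finite_subset by blast
  have "card Y \<le> (\<Sum>i\<le>k. card (set fs) ^ i)"
    using card_mono[OF finite_lists_length_le Ysub] by (simp add: card_lists_length_le)
  also have "\<dots> \<le> (card (set fs) + 1) ^ k" by (rule sum_powers_le)
  also have "\<dots> \<le> Suc N ^ k" using card_length[of fs] fs(1) by (intro power_mono) auto
  finally have cY: "card Y \<le> Suc N ^ k" .
  have cA: "card (A ys) * card F ^ (d + 1) \<le> d ^ k * card (forms d)" if ys: "ys \<in> Y" for ys
  proof -
    have lst: "last ys \<in> G (int d)"
      using ys fs(2) Ysub unfolding Y_def G_int by (metis (mono_tags, lifting) Y_def last_in_set mem_Collect_eq subset_iff)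
    have "length (diffs ys) < k"
      using ys by (cases ys) (auto simp: diffs_def Y_def)
    moreover have "good d (diffs ys)" using ys by (intro fs(3)) (auto simp: Y_def)
    ultimately have "card {g \<in> forms d. \<not> good d (diffs ys @ [g])} * card F ^ (d + 1) \<le> d ^ k * card (forms d)"
      using good_extend[OF _ _ d q] by blast
    moreover have "card (A ys) \<le> card {g \<in> forms d. \<not> good d (diffs ys @ [g])}"
    proof (rule card_inj_on_le)
      show "inj_on (\<lambda>f. f - last ys) (A ys)" by (rule inj_onI) simp
      show "(\<lambda>f. f - last ys) ` A ys \<subseteq> {g \<in> forms d. \<not> good d (diffs ys @ [g])}"
        unfolding A_def using G_diff[OF _ lst] by (auto simp: G_int)
    qed (simp add: finite_forms)
    ultimately show ?thesis by (meson le_trans mult_le_mono1)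
  qed
  have "card (\<Union>ys\<in>Y. A ys) * card F ^ (d + 1) \<le> (\<Sum>ys\<in>Y. card (A ys)) * card F ^ (d + 1)"
    using card_UN_le[OF fY, of A] by (rule mult_right_mono) simp
  also have "\<dots> \<le> card Y * (d ^ k * card (forms d))"
    unfolding sum_distrib_right
    using sum_bounded_above[of Y "\<lambda>ys. card (A ys) * card F ^ (d + 1)" "d ^ k * card (forms d)"] cA
    by simp
  also have "\<dots> \<le> Suc N ^ k * (d ^ k * card (forms d))" using cY by (rule mult_right_mono) simp
  also have "\<dots> = (Suc N * d) ^ k * card (forms d)"
    by (simp only: power_mult_distrib mult.assoc)
  also have "\<dots> < card F ^ (d + 1) * card (forms d)"
    using Suc.prems card_G_pos[of "int d"] by (intro mult_strict_right_mono) (auto simp: G_int)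
  finally have "card (\<Union>ys\<in>Y. A ys) < card (forms d)" by (simp add: mult.commute)
  moreover have "finite (\<Union>ys\<in>Y. A ys)"
    using fY finite_forms by (auto simp: A_def)
  ultimately have "\<not> forms d \<subseteq> (\<Union>ys\<in>Y. A ys)"
    using card_mono linorder_not_le by blast
  then obtain f where f: "f \<in> forms d" "f \<notin> (\<Union>ys\<in>Y. A ys)" by blast
  have "good d (diffs ys)" if ys: "subseq ys (f # fs)" "ys \<noteq> []" "length ys \<le> k + 1" for ys
  proof (cases "subseq ys fs")
    case False
    from ys(1) obtain zs where zs: "ys = f # zs" "subseq zs fs"
      by (cases rule: list_emb.cases) (use False ys(2) in auto)
    show ?thesis
    proof (cases "zs = []")
      case True
      then show ?thesis using good_Nil by (simp add: zs diffs_def)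
    next
      case False
      then have "zs \<in> Y" using zs ys by (simp add: Y_def)
      then have "good d (diffs zs @ [f - last zs])" using f by (auto simp: A_def)
      then show ?thesis using False by (simp add: zs diffs_Cons)
    qed
  qed (use ys fs(3) in blast)
  then show ?case using fs f(1) by (intro exI[of _ "f # fs"]) auto
qed

section \<open>The bipartite graph of forms and points\<close>

lemma exists_bipartite:
  assumes d: "0 < d" and q: "d * d ^ k * d ^ k + d * d ^ k < card F"
    and N: "(N * d) ^ k < card F ^ (d + 1)"
  shows "\<exists>R. (\<forall>i<N. card {b\<in>chart \<times> F. R i b} = card F ^ k) \<and>
    (\<forall>S\<subseteq>{..<N}. card S = k + 1 \<longrightarrow> card {b\<in>chart \<times> F. \<forall>i\<in>S. R i b} \<le> d ^ k)"
proof -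
  obtain fs where fs: "length fs = N" "set fs \<subseteq> forms d"
    "\<And>ys. subseq ys fs \<Longrightarrow> ys \<noteq> [] \<Longrightarrow> length ys \<le> k + 1 \<Longrightarrow> good d (diffs ys)"
    using exists_good_family[OF assms] by blast
  define R where "R i b \<longleftrightarrow> (fs ! i) (fst b) = snd b" for i b
  have "card {b\<in>chart \<times> F. R i b} = card F ^ k" if "i < N" for i
  proof -
    have "fs ! i \<in> forms d" using that fs by auto
    then have "{b\<in>chart \<times> F. R i b} = (\<lambda>z. (z, (fs ! i) z)) ` chart"
      using forms_F by (auto simp: R_def)
    then show ?thesis using card_chart by (simp add: card_image inj_on_def)
  qed
  moreover have "card {b\<in>chart \<times> F. \<forall>i\<in>S. R i b} \<le> d ^ k" if S: "S \<subseteq> {..<N}" "card S = k + 1" for S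
  proof -
    define ys where "ys = nths fs S"
    have "{i. i < length fs \<and> i \<in> S} = S" using S fs(1) by auto
    then have len: "length ys = k + 1" using S(2) by (simp add: ys_def length_nths)
    then have ne: "ys \<noteq> []" by auto
    have "good d (diffs ys)"
      using len ne subseq_conv_nths[of ys fs] by (intro fs(3)) (auto simp: ys_def)
    moreover have "length (diffs ys) = k" using len by (simp add: diffs_def)
    ultimately have "card {z\<in>chart. \<forall>g\<in>set (diffs ys). g z = 0} \<le> d ^ k" by (rule good_zeros)
    \<comment> \<open>A common neighbour is determined by its point, as its second entry is the
      value there of any chosen form; at that point all differences vanish.\<close>
    moreover have "card {b\<in>chart \<times> F. \<forall>i\<in>S. R i b} \<le> card {z\<in>chart. \<forall>g\<in>set (diffs ys). g z = 0}"
    proof (rule card_inj_on_le)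
      have "S \<noteq> {}" using S(2) by auto
      then show "inj_on fst {b\<in>chart \<times> F. \<forall>i\<in>S. R i b}"
        by (fastforce simp: inj_on_def R_def)
      have "f (fst b) = snd b" if "f \<in> set ys" "\<forall>i\<in>S. R i b" for f b
        using that by (auto simp: ys_def set_nths R_def)
      then have "f (fst b) = last ys (fst b)" if "f \<in> set ys" "\<forall>i\<in>S. R i b" for f b
        using that ne last_in_set by metis
      then show "fst ` {b\<in>chart \<times> F. \<forall>i\<in>S. R i b} \<subseteq> {z\<in>chart. \<forall>g\<in>set (diffs ys). g z = 0}"
        by (auto simp: diffs_def dest!: in_set_butlastD)
      show "finite {z\<in>chart. \<forall>g\<in>set (diffs ys). g z = 0}" using card_chart by simp
    qed
    ultimately show ?thesis by linarith
  qed
  ultimately show ?thesis by blast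
qed

end

section \<open>Finite fields of characteristic two\<close>

text \<open>All fields of order \<open>2^e\<close> live in the one type \<open>bit alg_closure\<close>; powers of two are dense enough to
  replace a prime between \<open>x\<close> and a multiple of \<open>x\<close>.\<close>

definition GF :: "nat \<Rightarrow> bit alg_closure set" where
  "GF e = {x. x ^ (2 ^ e) = x}"

lemma CHAR_bit: "CHAR(bit) = 2"
proof -
  have *: "(of_nat n :: bit) = of_bool (odd n)" for n by (induction n) auto
  show ?thesis by (rule CHAR_eqI) (auto simp: *)
qed

text \<open>The roots of \<open>x^(2^e) - x\<close> in an algebraically closed field: in
  characteristic two the derivative is the constant \<open>- 1\<close>, so all roots are
  simple.\<close>

lemma card_GF:
  assumes "1 \<le> e"
  shows "finite (GF e)" "card (GF e) = 2 ^ e"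
proof -
  define p :: "bit alg_closure poly" where "p = monom 1 (2 ^ e) + monom (- 1) 1"
  have "1 < (2::nat) ^ e" using one_less_power[of "2::nat" e] assms by simp
  then have deg: "degree p = 2 ^ e"
    unfolding p_def by (subst degree_add_eq_left) (auto simp: degree_monom_eq)
  have p0: "p \<noteq> 0" using deg \<open>1 < 2 ^ e\<close> by auto
  have two: "of_nat (2 ^ e) = (0 :: bit alg_closure)"
    unfolding of_nat_eq_0_iff_char_dvd using assms by (simp add: CHAR_bit)
  have roots: "{x. poly p x = 0} = GF e"
    by (auto simp: p_def GF_def poly_monom)
  have deriv: "poly (pderiv p) x = - 1" for x
    using two assms by (simp add: p_def pderiv_add pderiv_monom poly_monom power_0_left)
  have "count (proots p) x = 1" if x: "x \<in># proots p" for x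
  proof (rule ccontr)
    assume "count (proots p) x \<noteq> 1"
    moreover have "0 < count (proots p) x" using x by simp
    ultimately have "2 \<le> order x p" using p0 by simp
    define a where "a = [:- x, 1:]"
    have "a ^ 2 dvd p"
      unfolding a_def using \<open>2 \<le> _\<close> order_1[of x p] power_le_dvd by blast
    then obtain u where u: "p = a ^ 2 * u" by (elim dvdE)
    have "poly a x = 0" by (simp add: a_def)
    then have "poly (pderiv p) x = 0"
      unfolding u power2_eq_square mult.assoc pderiv_mult by simp
    then show False using deriv[of x] by simp
  qed
  then have "size (proots p) = card (set_mset (proots p))"
    by (simp add: size_multiset_overloaded_eq)
  moreover have "size (proots p) = degree p"
  proof -
    obtain A where A: "size A = degree p"
      "p = smult (lead_coeff p) (\<Prod>x\<in>#A. [:-x, 1:])"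
      using alg_closed_imp_factorization[OF p0] by blast
    have nz: "(\<Prod>x\<in>#B. [:-x, 1:]) \<noteq> 0" for B :: "bit alg_closure multiset"
      by (induction B) (simp_all del: mult_pCons_left)
    have "proots p = proots (\<Prod>x\<in>#A. [:-x, 1:])"
      by (subst A(2)) (use p0 in simp)
    also have "\<dots> = A"
    proof (induction A)
      case (add x B)
      have "proots ([:-x, 1:] * (\<Prod>x\<in>#B. [:-x, 1:])) = proots [:-x, 1:] + proots (\<Prod>x\<in>#B. [:-x, 1:])"
        by (intro proots_mult nz) simp
      then show ?case by (simp add: add del: mult_pCons_left)
    qed simp
    finally show ?thesis using A by simp
  qed
  ultimately show "card (GF e) = 2 ^ e" "finite (GF e)"
    using p0 roots deg poly_roots_finite[OF p0] by simp_all
qed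

text \<open>Closure under addition is the additivity of iterated Frobenius, and negation is the
  identity in characteristic two.\<close>

lemma finite_subfield_GF:
  assumes "1 \<le> e"
  shows "finite_subfield (GF e)"
proof
  fix a b :: "bit alg_closure"
  have "prime CHAR(bit alg_closure)" by (simp add: CHAR_bit)
  from freshmans_dream'[OF this refl, of a b e]
  show "a + b \<in> GF e" if "a \<in> GF e" "b \<in> GF e"
    using that by (simp add: GF_def CHAR_bit)
  show "- a \<in> GF e" if "a \<in> GF e"
  proof -
    have "(2 :: bit alg_closure) = 0"
      using of_nat_CHAR[where 'a = "bit alg_closure"] by (simp add: CHAR_bit)
    then show ?thesis using that assms by (simp add: GF_def)
  qed
  show "a * b \<in> GF e" if "a \<in> GF e" "b \<in> GF e"
    using that by (simp add: GF_def power_mult_distrib)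
  show "inverse a \<in> GF e" if "a \<in> GF e"
    using that by (simp add: GF_def power_inverse)
  \<comment> \<open>If there were only \<open>N\<close> elements, \<open>GF (Suc N)\<close> would
    already be too large.\<close>
  show "infinite (UNIV :: bit alg_closure set)"
  proof
    assume fin: "finite (UNIV :: bit alg_closure set)"
    define N where "N = card (UNIV :: bit alg_closure set)"
    have "2 ^ Suc N \<le> N"
      using card_mono[OF fin, of "GF (Suc N)"] card_GF(2)[of "Suc N"] by (simp add: N_def)
    then show False using less_exp[of "Suc N"] by linarith
  qed
qed (use card_GF[OF assms] in \<open>auto simp: GF_def\<close>)

text \<open>The right vertices are renumbered below \<open>q^(k+1)\<close>, where
  \<open>q = 2^e\<close>, so that the field disappears from the conclusion.\<close>

lemma exists_bipartite_relation:
  assumes d: "0 < d" and e: "1 \<le> e" and q: "d * d ^ k * d ^ k + d * d ^ k < 2 ^ e"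
    and N: "(N * d) ^ k < (2 ^ e) ^ (d + 1)"
  obtains R :: "nat \<Rightarrow> nat \<Rightarrow> bool" where
    "\<And>i. i < N \<Longrightarrow> card {b. b < (2 ^ e) ^ (k + 1) \<and> R i b} = (2 ^ e) ^ k"
    "\<And>S. S \<subseteq> {..<N} \<Longrightarrow> card S = k + 1 \<Longrightarrow> card {b. b < (2 ^ e) ^ (k + 1) \<and> (\<forall>i\<in>S. R i b)} \<le> d ^ k"
proof -
  interpret finite_subfield "GF e" k by (rule finite_subfield_GF[OF e])
  note cF = card_GF[OF e]
  obtain R where R: "\<And>i. i < N \<Longrightarrow> card {b\<in>chart \<times> GF e. R i b} = (2 ^ e) ^ k"
    "\<And>S. S \<subseteq> {..<N} \<Longrightarrow> card S = k + 1 \<Longrightarrow> card {b\<in>chart \<times> GF e. \<forall>i\<in>S. R i b} \<le> d ^ k"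
    using exists_bipartite[OF d] q N unfolding cF by blast
  have "finite (chart \<times> GF e)" "card (chart \<times> GF e) = (2 ^ e) ^ (k + 1)"
    using card_chart cF by (simp_all add: card_cartesian_product)
  then obtain h where h: "bij_betw h {..<((2::nat) ^ e) ^ (k + 1)} (chart \<times> GF e)"
    using ex_bij_betw_nat_finite[of "chart \<times> GF e"] by (auto simp only: atLeast0LessThan)
  have tr: "card {b. b < (2 ^ e) ^ (k + 1) \<and> P (h b)} = card {b\<in>chart \<times> GF e. P b}" for P
  proof -
    have "bij_betw h {b. b < (2 ^ e) ^ (k + 1) \<and> P (h b)} {b\<in>chart \<times> GF e. P b}"
      using h
    proof (rule bij_betw_subset)
      show "h ` {b. b < (2 ^ e) ^ (k + 1) \<and> P (h b)} = {b\<in>chart \<times> GF e. P b}"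
        unfolding bij_betw_imp_surj_on[OF h, symmetric] by auto
    qed auto
    then show ?thesis by (rule bij_betw_same_card)
  qed
  show ?thesis
    by (rule that[of "\<lambda>i b. R i (h b)"]) (simp_all only: tr tr[of "\<lambda>b. \<forall>i\<in>S. R i b" for S] R)
qed

section \<open>From bipartite graphs to \<open>r\<close>-graphs\<close>

text \<open>Left vertices stand for tuples from the first \<open>r - 1\<close> parts, and a tuple
  adjacent to \<open>b\<close> becomes the edge formed by its entries and \<open>b\<close>. An
  ordered copy would give a box of tuples, of the size in the hypothesis, with \<open>t\<close>
  common neighbours.\<close>

lemma zarankiewicz_ge:
  fixes R :: "nat \<Rightarrow> nat \<Rightarrow> bool"
  assumes r: "2 \<le> r" and t: "0 < t"
    and R: "\<And>S. S \<subseteq> {..<(\<Prod>i=1..<r. m i)} \<Longrightarrow> card S = (\<Prod>i=1..<r. s i) \<Longrightarrow>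
      card {b. b < n \<and> (\<forall>i\<in>S. R i b)} < t"
  shows "(\<Sum>i<(\<Prod>i=1..<r. m i). card {b. b < n \<and> R i b}) \<le> zarankiewicz r (m(r := n)) (s(r := t))"
proof -
  define M where "M = (\<Prod>i=1..<r. m i)"
  define P where "P = PiE {1..<r} (\<lambda>i. {..<m i})"
  have P: "finite P" "card P = M" unfolding P_def M_def by (auto intro: finite_PiE simp: card_PiE)
  then obtain enc where enc: "bij_betw enc P {..<M}"
    using ex_bij_betw_finite_nat[of P] by (auto simp: atLeast0LessThan)
  define V where "V i = (\<lambda>a. prod_encode (i, a)) ` {..<(m(r := n)) i}" for i
  \<comment> \<open>Tagging each entry with the index of its part keeps the parts disjoint and makes
    the tuple recoverable from the edge.\<close>
  define edge where "edge y = (\<lambda>i. prod_encode (i, y i)) ` {1..r}" for y :: "nat \<Rightarrow> nat"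
  have edge_eqD: "y i = y' i" if "edge y = edge y'" "i \<in> {1..r}" for y y' i
  proof -
    have "prod_encode (i, y i) \<in> edge y'" using that by (auto simp: edge_def)
    then show ?thesis by (auto simp: edge_def)
  qed
  define Q where "Q = (SIGMA x:P. {b. b < n \<and> R (enc x) b})"
  define E where "E = (\<lambda>(x, b). edge (x(r := b))) ` Q"
  have rr: "r \<in> {1..r}" using r by simp
  have inj: "x = x' \<and> b = b'"
    if "x \<in> P" "x' \<in> P" "edge (x(r := b)) = edge (x'(r := b'))" for x x' b b'
  proof
    show "b = b'" using edge_eqD[OF that(3) rr] by simp
    show "x = x'"
    proof (rule PiE_ext[OF that(1,2)[unfolded P_def]])
      fix i assume "i \<in> {1..<r}"
      then show "x i = x' i" using edge_eqD[OF that(3), of i] by (simp split: if_splits)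
    qed
  qed
  have "card E = card Q"
    unfolding E_def by (rule card_image) (use inj in \<open>auto simp: inj_on_def Q_def\<close>)
  also have "\<dots> = (\<Sum>x\<in>P. card {b. b < n \<and> R (enc x) b})"
    unfolding Q_def using P by (intro card_SigmaI) auto
  also have "\<dots> = (\<Sum>i<M. card {b. b < n \<and> R i b})"
    by (rule sum.reindex_bij_betw[OF enc])
  finally have cardE: "card E = (\<Sum>i<M. card {b. b < n \<and> R i b})" .
  have edgeV: "edge (x(r := b)) \<subseteq> (\<Union>i\<in>{1..r}. V i)" if "(x, b) \<in> Q" for x b
    using that by (force simp: edge_def V_def Q_def P_def PiE_def Pi_def)
  have cV: "card (V i) = (m(r := n)) i" for i
    unfolding V_def by (subst card_image) (auto simp: inj_on_def)
  have "r_graph r (\<Union>i\<in>{1..r}. V i) E"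
    unfolding r_graph_def
  proof (intro conjI ballI)
    fix e assume "e \<in> E"
    then obtain x b where e: "(x, b) \<in> Q" "e = edge (x(r := b))" by (auto simp: E_def)
    show "e \<subseteq> (\<Union>i\<in>{1..r}. V i)" using edgeV e by blast
    show "card e = r" unfolding e edge_def by (subst card_image) (auto simp: inj_on_def)
  qed (simp add: V_def)
  moreover have "r_partite r (\<Union>i\<in>{1..r}. V i) E V"
    unfolding r_partite_def
  proof (intro conjI ballI)
    show "disjoint_family_on V {1..r}" by (auto simp: disjoint_family_on_def V_def)
    fix e i assume "e \<in> E" and i: "i \<in> {1..r}"
    then obtain x b where e: "(x, b) \<in> Q" "e = edge (x(r := b))" by (auto simp: E_def)
    have "v = prod_encode (i, (x(r := b)) i)" if "v \<in> e \<inter> V i" for v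
      using that by (auto simp: e edge_def V_def)
    moreover have "prod_encode (i, (x(r := b)) i) \<in> e \<inter> V i"
      using i e(1) by (auto simp: e(2) edge_def V_def Q_def P_def PiE_def Pi_def)
    ultimately show "\<exists>!v. v \<in> e \<inter> V i" by blast
  qed simp
  moreover have "\<not> contains_ordered_K r E V (s(r := t))"
  proof
    assume "contains_ordered_K r E V (s(r := t))"
    then obtain S where S: "\<And>i. i \<in> {1..r} \<Longrightarrow> S i \<subseteq> V i"
      "\<And>i. i \<in> {1..r} \<Longrightarrow> card (S i) = (s(r := t)) i"
      "\<And>v. v \<in> Pi {1..r} S \<Longrightarrow> v ` {1..r} \<in> E"
      unfolding contains_ordered_K_def by blast
    define T where "T i = {a. prod_encode (i, a) \<in> S i}" for i
    have ST: "S i = (\<lambda>a. prod_encode (i, a)) ` T i" if "i \<in> {1..r}" for i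
      using S(1)[OF that] by (auto simp: T_def V_def)
    have cT: "card (T i) = (s(r := t)) i" if "i \<in> {1..r}" for i
      using S(2)[OF that] unfolding ST[OF that] by (subst (asm) card_image) (auto simp: inj_on_def)
    have TV: "T i \<subseteq> {..<(m(r := n)) i}" if "i \<in> {1..r}" for i
      using S(1)[OF that] by (auto simp: T_def V_def)
    define W where "W = PiE {1..<r} T"
    have WP: "W \<subseteq> P" unfolding W_def P_def using TV by (intro PiE_mono) force
    have adj: "R (enc x) b" if x: "x \<in> W" and b: "b \<in> T r" for x b
    proof -
      have "(\<lambda>i. prod_encode (i, (x(r := b)) i)) \<in> Pi {1..r} S"
        using x b by (auto simp: W_def T_def PiE_def Pi_def)
      from S(3)[OF this] have "edge (x(r := b)) \<in> E" by (simp add: edge_def)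
      then obtain x' b' where q: "(x', b') \<in> Q" "edge (x(r := b)) = edge (x'(r := b'))"
        by (auto simp: E_def)
      then have "x = x' \<and> b = b'" using x WP by (intro inj) (auto simp: Q_def)
      then show ?thesis using q by (simp add: Q_def)
    qed
    have "card (enc ` W) = card W"
      using bij_betw_imp_inj_on[OF enc] WP by (intro card_image) (rule inj_on_subset)
    also have "\<dots> = (\<Prod>i\<in>{1..<r}. card (T i))" unfolding W_def by (simp add: card_PiE)
    also have "\<dots> = (\<Prod>i\<in>{1..<r}. s i)" using cT by (intro prod.cong) auto
    finally have "card {b. b < n \<and> (\<forall>i\<in>enc ` W. R i b)} < t"
      using bij_betw_imp_surj_on[OF enc] WP by (intro R) (auto simp: M_def)
    moreover have "card (T r) \<le> card {b. b < n \<and> (\<forall>i\<in>enc ` W. R i b)}"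
      using TV[OF rr] adj by (intro card_mono) auto
    ultimately show False using cT[OF rr] by simp
  qed
  ultimately have "zarankiewicz_graph r (m(r := n)) (s(r := t)) (\<Union>i\<in>{1..r}. V i) E V"
    unfolding zarankiewicz_graph_def using cV by blast
  then have "card E \<le> zarankiewicz r (m(r := n)) (s(r := t))"
    unfolding zarankiewicz_def by (intro Max_ge[OF finite_zarankiewicz_set]) blast
  then show ?thesis unfolding cardE M_def .
qed

text \<open>\<open>M\<close> may exceed the number of available forms by a constant factor, and
  \<open>n\<close> may exceed \<open>q^(k+1)\<close> with \<open>q = 2^e\<close>. Surplus vertices
  on both sides stay isolated, which costs the factor in front of the edge count.\<close>

lemma exists_relation_many_edges:
  assumes d: "0 < d" and k: "0 < k" and q: "d * d ^ k * d ^ k + d * d ^ k < 2 ^ e"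
    and n: "(2 ^ e) ^ (k + 1) \<le> n" and M: "0 < M" "M ^ k \<le> (2 * 2 ^ e) ^ (d + 1)"
  obtains R :: "nat \<Rightarrow> nat \<Rightarrow> bool" where
    "\<And>S. S \<subseteq> {..<M} \<Longrightarrow> card S = k + 1 \<Longrightarrow> card {b. b < n \<and> (\<forall>i\<in>S. R i b)} \<le> d ^ k"
    "M * (2 ^ e) ^ k \<le> (2 * d * 2 ^ (d + 1) + 1) * (\<Sum>i<M. card {b. b < n \<and> R i b})"
proof -
  \<comment> \<open>\<open>K\<close> absorbs the constants lost between the bound on
    \<open>M ^ k\<close> and the strict bound on \<open>(N * d) ^ k\<close>: a factor
    \<open>2\<close> from rounding \<open>M div K\<close> up, the factor \<open>d\<close>, and
    \<open>2 ^ (d + 1)\<close>.\<close>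
  define K where "K = 2 * d * 2 ^ (d + 1) + 1"
  define N where "N = M div K + 1"
  have K: "2 \<le> K" using d by (simp add: K_def)
  have dk: "d ^ k \<le> d * d ^ k" using d by simp
  have e: "1 \<le> e"
    using q d by (cases e) auto
  have MN: "M \<le> N * K"
    unfolding N_def using K by (metis Suc_eq_plus1 dividend_less_div_times less_imp_le mult_Suc pos2 less_le_trans add.commute)
  have NM: "N \<le> M \<and> (N * d) ^ k < (2 ^ e) ^ (d + 1)"
  proof (cases "M < K")
    case True
    then have "N = 1" by (simp add: N_def)
    have "d ^ k < 2 ^ e" using dk q by linarith
    also have "\<dots> \<le> (2 ^ e) ^ (d + 1)" by (rule self_le_power) auto
    finally have "(N * d) ^ k < (2 ^ e) ^ (d + 1)" by (simp only: \<open>N = 1\<close> mult_1)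
    then show ?thesis using M \<open>N = 1\<close> by auto
  next
    case False
    have "M div K * K \<le> M" by simp
    moreover have "N * K = M div K * K + K" by (simp add: N_def)
    ultimately have NK: "N * K \<le> 2 * M" using False by linarith
    have "N * 2 \<le> N * K" using K by simp
    then have "N \<le> M" using NK by linarith
    have "(N * d) ^ k * K ^ k = (N * K * d) ^ k" by (simp add: power_mult_distrib)
    also have "\<dots> \<le> (2 * M * d) ^ k" using NK by (intro power_mono mult_right_mono) auto
    also have "\<dots> = (2 * d) ^ k * M ^ k" by (simp add: power_mult_distrib)
    also have "\<dots> \<le> (2 * d) ^ k * (2 * 2 ^ e) ^ (d + 1)" using M(2) by (rule mult_left_mono) simp
    also have "\<dots> = (2 * d) ^ k * 2 ^ (d + 1) * (2 ^ e) ^ (d + 1)"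
      by (simp only: power_mult_distrib mult.assoc)
    also have "\<dots> \<le> (2 * d) ^ k * (2 ^ (d + 1)) ^ k * (2 ^ e) ^ (d + 1)"
      using self_le_power[of "2 ^ (d + 1) :: nat" k] k by (intro mult_right_mono mult_left_mono) auto
    also have "\<dots> = (2 * d * 2 ^ (d + 1)) ^ k * (2 ^ e) ^ (d + 1)"
      by (simp only: power_mult_distrib)
    also have "\<dots> < K ^ k * (2 ^ e) ^ (d + 1)"
      using k by (intro mult_strict_right_mono power_strict_mono) (auto simp: K_def)
    finally have "(N * d) ^ k < (2 ^ e) ^ (d + 1)" by (simp add: mult.commute)
    with \<open>N \<le> M\<close> show ?thesis by simp
  qed
  obtain R :: "nat \<Rightarrow> nat \<Rightarrow> bool" where
    R1: "\<And>i. i < N \<Longrightarrow> card {b. b < (2 ^ e) ^ (k + 1) \<and> R i b} = (2 ^ e) ^ k" and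
    R2: "\<And>S. S \<subseteq> {..<N} \<Longrightarrow> card S = k + 1 \<Longrightarrow> card {b. b < (2 ^ e) ^ (k + 1) \<and> (\<forall>i\<in>S. R i b)} \<le> d ^ k"
    using exists_bipartite_relation[OF d e q, of N] NM by blast
  define R' where "R' i b \<longleftrightarrow> i < N \<and> b < (2 ^ e) ^ (k + 1) \<and> R i b" for i b
  have R'1: "card {b. b < n \<and> (\<forall>i\<in>S. R' i b)} \<le> d ^ k" if S: "card S = k + 1" for S
  proof (cases "S \<subseteq> {..<N}")
    case True
    moreover have "S \<noteq> {}" using S by auto
    ultimately have "{b. b < n \<and> (\<forall>i\<in>S. R' i b)} = {b. b < (2 ^ e) ^ (k + 1) \<and> (\<forall>i\<in>S. R i b)}"
      using n by (fastforce simp: R'_def)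
    then show ?thesis using R2[OF True S] by simp
  next
    case False
    then have none: "{b. b < n \<and> (\<forall>i\<in>S. R' i b)} = {}" by (auto simp: R'_def)
    show ?thesis unfolding none by simp
  qed
  have "{b. b < n \<and> R' i b} = {b. b < (2 ^ e) ^ (k + 1) \<and> R i b}" if "i < N" for i
    using that n by (auto simp: R'_def)
  then have "(\<Sum>i<N. card {b. b < n \<and> R' i b}) = N * (2 ^ e) ^ k" using R1 by simp
  moreover have "(\<Sum>i<N. card {b. b < n \<and> R' i b}) \<le> (\<Sum>i<M. card {b. b < n \<and> R' i b})"
    using NM by (intro sum_mono2) auto
  ultimately have "K * (N * (2 ^ e) ^ k) \<le> K * (\<Sum>i<M. card {b. b < n \<and> R' i b})" by simp
  moreover have "M * (2 ^ e) ^ k \<le> N * K * (2 ^ e) ^ k" using MN by (rule mult_right_mono) simp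
  moreover have "N * K * (2 ^ e) ^ k = K * (N * (2 ^ e) ^ k)" by (simp only: ac_simps)
  ultimately have "M * (2 ^ e) ^ k \<le> K * (\<Sum>i<M. card {b. b < n \<and> R' i b})" by linarith
  then show ?thesis using R'1 unfolding K_def by (intro that[of R'])
qed

section \<open>Choice of the parameters and the final estimate\<close>

lemma exists_degree:
  fixes t k :: nat
  assumes "2 \<le> t" "0 < k"
  obtains d where "0 < d" "d ^ k < t" "t \<le> (d + 1) ^ k"
proof -
  define d where "d = (LEAST d. t \<le> (d + 1) ^ k)"
  have "t \<le> (t + 1) ^ 1" by simp
  also have "\<dots> \<le> (t + 1) ^ k" using assms by (intro power_increasing) auto
  finally have d: "t \<le> (d + 1) ^ k" unfolding d_def by (rule LeastI)
  have "0 < d" using d assms by (cases d) auto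
  have "\<not> t \<le> (d - 1 + 1) ^ k"
    using not_less_Least[of "d - 1" "\<lambda>d. t \<le> (d + 1) ^ k"] \<open>0 < d\<close> by (simp add: d_def)
  with d \<open>0 < d\<close> show ?thesis by (intro that[of d]) auto
qed

lemma power_powr_divide: "0 < x \<Longrightarrow> 0 < n \<Longrightarrow> (x ^ n) powr (a / real n) = x powr a" for x a :: real
  by (simp add: powr_powr flip: powr_realpow)

theorem theorem1p3:
  fixes r t p :: nat and s :: "nat \<Rightarrow> nat"
  assumes "2 \<le> r"
    and "\<forall>i\<in>{1..<r}. 0 < s i"
    and "0 < t"
    and "p = (\<Prod>i=1..<r. s i)"
    and "2 \<le> p" and "p \<le> t"
  shows "\<exists>c::real. 0 < c \<and>
    (\<forall>(m :: nat \<Rightarrow> nat) (n :: nat).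
       (\<forall>i\<in>{1..<r}. 0 < m i) \<longrightarrow> 0 < n \<longrightarrow>
       real (\<Prod>i=1..<r. m i)
         \<le> real n powr (real t powr (1 / (real p - 1)) / (real p * (real p - 1))) \<longrightarrow>
       real (zarankiewicz r (m(r := n)) (s(r := t)))
         \<ge> c * real (\<Prod>i=1..<r. m i) * real n powr (1 - 1 / real p))"
proof -
  define k where "k = p - 1"
  have k: "0 < k" "p = k + 1" "real p - 1 = real k" "real p = real k + 1"
    using assms(5) by (auto simp: k_def)
  obtain d where d: "0 < d" "d ^ k < t" "t \<le> (d + 1) ^ k"
    using exists_degree[of t k] assms k by auto
  define Q where "Q = d * d ^ k * d ^ k + d * d ^ k"
  define K where "K = 2 * d * 2 ^ (d + 1) + 1"
  \<comment> \<open>The first term serves bounded \<open>n\<close>, the second large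
    \<open>n\<close>: there \<open>K\<close> is the loss of
    \<open>exists_relation_many_edges\<close>, and \<open>2 ^ k\<close> comes from rounding the
    \<open>p\<close>-th root of \<open>n\<close> to a power of two.\<close>
  define c :: real where "c = min (1 / (2 * Q) ^ p) (1 / (K * 2 ^ k))"
  have "0 < Q" using d by (simp add: Q_def)
  have "0 < K" by (simp add: K_def)
  have c: "0 < c" using \<open>0 < Q\<close> \<open>0 < K\<close> by (simp add: c_def)
  \<comment> \<open>Replaces the real exponent of the hypothesis by the integer
    \<open>d + 1\<close>, the number of coefficients of a binary form of degree
    \<open>d\<close>.\<close>
  have root_t: "real t powr (1 / real k) \<le> real (d + 1)"
  proof -
    have "real t \<le> real ((d + 1) ^ k)" using d(3) by (simp only: of_nat_le_iff)
    then have "real t powr (1 / real k) \<le> real ((d + 1) ^ k) powr (1 / real k)"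
      by (intro powr_mono2) simp_all
    also have "\<dots> = real (d + 1)"
      using power_powr_divide[of "real (d + 1)" k 1] k(1) by (simp only: of_nat_power) simp
    finally show ?thesis .
  qed
  have main: "c * real (\<Prod>i=1..<r. m i) * real n powr (1 - 1 / real p)
      \<le> real (zarankiewicz r (m(r := n)) (s(r := t)))"
    if m: "\<forall>i\<in>{1..<r}. 0 < m i" and n: "0 < n"
      and mn: "real (\<Prod>i=1..<r. m i)
         \<le> real n powr (real t powr (1 / (real p - 1)) / (real p * (real p - 1)))"
    for m :: "nat \<Rightarrow> nat" and n :: nat
  proof -
    define M where "M = (\<Prod>i=1..<r. m i)"
    have M: "0 < M" using m by (simp add: M_def)
    have "2 \<le> (2::nat) ^ p" using assms(5) self_le_power[of "2::nat" p] by simp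
    \<comment> \<open>The field order \<open>q = 2 ^ e\<close> is the \<open>p\<close>-th root of
      \<open>n\<close> rounded down to a power of two, so that root is less than
      \<open>2 * q\<close>.\<close>
    from ex_power_ivl1[OF this, of n] obtain e where "(2 ^ p) ^ e \<le> n" "n < (2 ^ p) ^ (e + 1)"
      using n by auto
    then have e: "(2 ^ e) ^ p \<le> n" "n < (2 * 2 ^ e) ^ p"
      by (simp_all add: power_mult[symmetric] mult.commute power_mult_distrib power_add)
    have pw: "real n powr (a / real p) \<le> (2 * 2 ^ e) powr a" if "0 \<le> a" for a
    proof -
      have "real n < real ((2 * 2 ^ e) ^ p)" using e(2) by (simp only: of_nat_less_iff)
      then have "real n \<le> (2 * 2 ^ e) ^ p" by simp
      then have "real n powr (a / real p) \<le> ((2 * 2 ^ e) ^ p) powr (a / real p)"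
        using that by (intro powr_mono2) auto
      also have "\<dots> = (2 * 2 ^ e) powr a"
        using assms(5) by (intro power_powr_divide) auto
      finally show ?thesis .
    qed
    show ?thesis
    proof (cases "2 ^ e \<le> Q")
      case True
      txt \<open>Here \<open>n\<close> is bounded, and all edges through one vertex of the last part suffice.\<close>
      have "(\<Sum>i<M. card {b. b < n \<and> b = 0}) \<le> zarankiewicz r (m(r := n)) (s(r := t))"
        unfolding M_def
      proof (rule zarankiewicz_ge[OF assms(1,3)])
        fix S assume "card S = (\<Prod>i=1..<r. s i)"
        then have "card S = p" using assms(4) by simp
        then have "S \<noteq> {}" using assms(5) by auto
        then have "{b. b < n \<and> (\<forall>i\<in>S. b = 0)} \<subseteq> {0}" by auto
        then have "card {b. b < n \<and> (\<forall>i\<in>S. b = 0)} \<le> card {0::nat}" by (intro card_mono) auto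
        then show "card {b. b < n \<and> (\<forall>i\<in>S. b = 0)} < t" using assms(5,6) by simp
      qed
      moreover have "{b. b < n \<and> b = 0} = {0}" using n by auto
      ultimately have z: "M \<le> zarankiewicz r (m(r := n)) (s(r := t))" by simp
      have "(2 * 2 ^ e) ^ p \<le> (2 * Q) ^ p" using True by (intro power_mono mult_left_mono) auto
      then have "n \<le> (2 * Q) ^ p" by (rule le_trans[OF less_imp_le[OF e(2)]])
      then have "real n \<le> real ((2 * Q) ^ p)" by (simp only: of_nat_le_iff)
      then have "real n \<le> real (2 * Q) ^ p" by simp
      moreover have "real n powr (1 - 1 / real p) \<le> real n powr 1"
        using n by (intro powr_mono) auto
      ultimately have "real n powr (1 - 1 / real p) \<le> real (2 * Q) ^ p" using n by simp
      moreover have "c \<le> 1 / real (2 * Q) ^ p" by (simp add: c_def)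
      ultimately have "c * real n powr (1 - 1 / real p) \<le> 1 / real (2 * Q) ^ p * real (2 * Q) ^ p"
        using c by (intro mult_mono) auto
      also have "\<dots> = 1" using \<open>0 < Q\<close> by simp
      finally have "c * real n powr (1 - 1 / real p) * real M \<le> 1 * real M"
        by (rule mult_right_mono) simp
      moreover have "real M \<le> real (zarankiewicz r (m(r := n)) (s(r := t)))" using z by simp
      moreover have "c * real M * real n powr (1 - 1 / real p) = c * real n powr (1 - 1 / real p) * real M"
        by simp
      ultimately show ?thesis unfolding M_def[symmetric] by linarith
    next
      case False
      \<comment> \<open>The \<open>k\<close>-th power cancels the factor \<open>k\<close> in the
        denominator of the exponent; the remaining \<open>p\<close>-th root of \<open>n\<close> is
        below \<open>2 * 2 ^ e\<close>.\<close>
      have "real M ^ k \<le> real ((2 * 2 ^ e) ^ (d + 1))"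
      proof -
        have "real M \<le> real n powr (real t powr (1 / real k) / (real p * real k))"
          using mn unfolding M_def k(3) .
        also have "\<dots> \<le> real n powr (real (d + 1) / (real p * real k))"
          using n root_t k(1) by (intro powr_mono divide_right_mono) auto
        finally have "real M ^ k \<le> (real n powr (real (d + 1) / (real p * real k))) ^ k"
          by (rule power_mono) simp
        also have "\<dots> = real n powr (real (d + 1) / real p)"
          using k(1) n by (simp add: powr_powr flip: powr_realpow)
        also have "\<dots> \<le> (2 * 2 ^ e) powr real (d + 1)" by (rule pw) simp
        also have "\<dots> = real ((2 * 2 ^ e) ^ (d + 1))"
          by (subst powr_realpow) auto
        finally show ?thesis .
      qed
      then have Mk: "M ^ k \<le> (2 * 2 ^ e) ^ (d + 1)" by (simp only: of_nat_le_iff flip: of_nat_power)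
      obtain R :: "nat \<Rightarrow> nat \<Rightarrow> bool" where
        R1: "\<And>S. S \<subseteq> {..<M} \<Longrightarrow> card S = k + 1 \<Longrightarrow> card {b. b < n \<and> (\<forall>i\<in>S. R i b)} \<le> d ^ k" and
        R2: "M * (2 ^ e) ^ k \<le> K * (\<Sum>i<M. card {b. b < n \<and> R i b})"
        using exists_relation_many_edges[OF d(1) k(1) _ _ M Mk, of n] False e(1)
        unfolding Q_def K_def k(2) not_le by blast
      have "(\<Sum>i<M. card {b. b < n \<and> R i b}) \<le> zarankiewicz r (m(r := n)) (s(r := t))"
        unfolding M_def
      proof (rule zarankiewicz_ge[OF assms(1,3)])
        fix S assume "S \<subseteq> {..<\<Prod>i=1..<r. m i}" "card S = (\<Prod>i=1..<r. s i)"
        then show "card {b. b < n \<and> (\<forall>i\<in>S. R i b)} < t"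
          using R1[of S] assms(4) d(2) k(2) by (simp add: M_def)
      qed
      then have "K * (\<Sum>i<M. card {b. b < n \<and> R i b}) \<le> K * zarankiewicz r (m(r := n)) (s(r := t))"
        by (rule mult_left_mono) simp
      with R2 have "M * (2 ^ e) ^ k \<le> K * zarankiewicz r (m(r := n)) (s(r := t))" by linarith
      then have "real (M * (2 ^ e) ^ k) \<le> real (K * zarankiewicz r (m(r := n)) (s(r := t)))"
        by (simp only: of_nat_le_iff)
      then have z: "real M * (2 ^ e) ^ k \<le> real K * real (zarankiewicz r (m(r := n)) (s(r := t)))"
        by simp
      have "1 - 1 / real p = real k / real p" using k by (simp add: field_simps)
      then have "real n powr (1 - 1 / real p) \<le> (2 * 2 ^ e) powr real k" using pw[of "real k"] by simp
      also have "\<dots> = 2 ^ k * (2 ^ e) ^ k" by (subst powr_realpow) (auto simp: power_mult_distrib)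
      finally have np: "real n powr (1 - 1 / real p) \<le> 2 ^ k * (2 ^ e) ^ k" .
      have "c * real M * real n powr (1 - 1 / real p) \<le> 1 / (K * 2 ^ k) * real M * (2 ^ k * (2 ^ e) ^ k)"
        using np c by (intro mult_mono) (auto simp: c_def)
      also have "\<dots> = (real M * (2 ^ e) ^ k) / K" by simp
      also have "\<dots> \<le> real (zarankiewicz r (m(r := n)) (s(r := t)))"
        using z \<open>0 < K\<close> by (simp add: field_simps)
      finally show ?thesis by (simp add: M_def)
    qed
  qed
  show ?thesis using c main by (intro exI[of _ c]) blast
qed

end
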